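(* Let $d\in\mathbb{N}$, $d\ge2$, $x\in\mathbb{R}^d$ and $\beta>d/2$. Then there exists a constant $L_{\beta,d}>0$, depending on $\beta,d$, such that for all $L\ge L_{\beta,d}$ the following holds. If a sequence of estimators $\{\widehat f_n(x)\}_{n\in\mathbb{N}}$ of $f(x)$, where $\widehat f_n(x)$ is based on the i.i.d. data $(S_1,U_1),\dots,(S_n,U_n)$ with density $\rho_d^{-1}\mathcal{R}[f]$, satisfies $$\sup_{n\in\mathbb{N}}\ \sup_{f\in\mathcal{W}^\beta(L)}\mathbb{E}_{\mathcal{R}[f]}\left[\left|\widehat f_n(x)-f(x)\right|^2\right]n^{\frac{2\beta-d}{2\beta+d-1}}\le\mathfrak{C}$$ for a constant $\mathfrak{C}>0$, then for any $\beta'\in(d/2,\beta)$ there exists a constant $\mathfrak{c}=\mathfrak{c}(\mathfrak{C},\beta,\beta',d)>0$, depending only on $\mathfrak{C},\beta,\beta',d$, such that $$\liminf_{n\to\infty}\ \sup_{f\in\mathcal{W}^{\beta'}(L)}\mathbb{E}_{\mathcal{R}[f]}\left[\left|\widehat f_n(x)-f(x)\right|^2\right]\left(\frac{n}{\log(n)}\right)^{\frac{2\beta'-d}{2\beta'+d-1}}\ge\mathfrak{c}.$$ Here the suprema are over all probability densities $f$ on $\mathbb{R}^d$ belonging to the respective class.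
   Context: $\|\cdot\|$ and $\langle\cdot,\cdot\rangle$ are the Euclidean norm and scalar product, $\mathbb{S}^{d-1}$ is the unit sphere of $\mathbb{R}^d$ with surface measure $\sigma^{d-1}$, and $\rho_d:=2\pi^{d/2}/\Gamma(d/2)$ is its total surface measure. $\lambda^d$ is Lebesgue measure on $\mathbb{R}^d$; $\mathbb{N}=\{1,2,\dots\}$. Radon transform: for $h\in L^1(\mathbb{R}^d)$ and $(s,u)\in\mathbb{S}^{d-1}\times\mathbb{R}$, $\mathcal{R}[h](s,u):=\int_{\{v\in\mathbb{R}^d:\langle v,s\rangle=u\}}h(v)\,dv$, integration being with respect to the hypersurface ($(d-1)$-dimensional Lebesgue) measure on the hyperplane. For a probability density $f$, $\rho_d^{-1}\mathcal{R}[f]$ is a probability density on $\mathbb{S}^{d-1}\times\mathbb{R}$ with respect to $\sigma^{d-1}\otimes\lambda^1$; $\mathbb{E}_{\mathcal{R}[f]}$ denotes expectation when the observations are i.i.d. with this density. Fourier transform: $\mathcal{F}_d[h](t):=\int_{\mathbb{R}^d}e^{i\langle t,y\rangle}h(y)\,d\lambda^d(y)$ (extended to $L^2(\mathbb{R}^d)$ as usual). A density $f$ with $\mathcal{F}_d[f]\in L^1(\mathbb{R}^d)$ (which holds for $f\in\mathcal{W}^{\alpha}(L)$ with $\alpha>d/2$) is identified with its continuous version, so that $f(x)$ is well defined. Sobolev ellipsoid: for $\alpha,L>0$, $\mathcal{W}^{\alpha}(L):=\{f\in L^2(\mathbb{R}^d):\int_{\mathbb{R}^d}(1+\|t\|^2)^{\alpha}|\mathcal{F}_d[f](t)|^2\,d\lambda^d(t)\le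 L\}$. An estimator $\widehat f_n(x)$ is any real-valued measurable function of $(S_1,U_1),\dots,(S_n,U_n)$. *)

theory Defs
  imports "HOL-Probability.Probability"
begin

text \<open>
  Throughout, \<open>\<real>\<^sup>d\<close> is \<^typ>\<open>real ^ 'n\<close> with \<open>d = CARD('n)\<close>.
\<close>

subsection \<open>Surface measure and hyperplane measure\<close>

text \<open>
  Polar coordinates: \<open>\<sigma>(A) = d \<cdot> \<lambda>\<^sup>d {r s | s \<in> A, 0 < r \<le> 1}\<close>. The null set \<open>{0}\<close> is
  removed so that the radial projection maps into the sphere.
\<close>
definition surface_measure :: "(real ^ 'n) measure" where
  "surface_measure =
     scale_measure (ennreal (real CARD('n)))
       (distr (restrict_space lborel (cball 0 1 - {0}))
              (restrict_space borel (sphere 0 1))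
              (\<lambda>v. v /\<^sub>R norm v))"

definition sphere_area :: "nat \<Rightarrow> real" where
  "sphere_area d = 2 * pi powr (real d / 2) / Gamma (real d / 2)"

definition orthonormal_basis_perp :: "real ^ 'n \<Rightarrow> (real ^ 'n) set \<Rightarrow> bool" where
  "orthonormal_basis_perp s B \<longleftrightarrow>
     pairwise orthogonal B \<and> (\<forall>b\<in>B. norm b = 1) \<and> span B = {v. v \<bullet> s = 0}"

text \<open>
  \<open>(d - 1)\<close>-dimensional Lebesgue measure on \<open>{v. v \<bullet> s = u}\<close> for a unit vector \<open>s\<close>, as a measure
  on the whole space. It is transported from a coordinate space along an orthonormal basis of
  the orthogonal complement of \<open>s\<close>; by the invariance of Lebesgue measure under linear
  isometries the choice of that basis is immaterial.
\<close>
definition hyperplane_measure :: "real ^ 'n \<Rightarrow> real \<Rightarrow> (real ^ 'n) measure" where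
  "hyperplane_measure s u =
     (let B = (SOME B. orthonormal_basis_perp s B)
      in distr (Pi\<^sub>M B (\<lambda>_. lborel)) borel (\<lambda>g. u *\<^sub>R s + (\<Sum>b\<in>B. g b *\<^sub>R b)))"

subsection \<open>Radon transform, Fourier transform, Sobolev ellipsoid\<close>

definition radon :: "(real ^ 'n \<Rightarrow> real) \<Rightarrow> real ^ 'n \<Rightarrow> real \<Rightarrow> real" where
  "radon h s u = (\<integral>v. h v \<partial>hyperplane_measure s u)"

definition fourier_integral :: "(real ^ 'n \<Rightarrow> real) \<Rightarrow> real ^ 'n \<Rightarrow> complex" where
  "fourier_integral h t = (\<integral>y. exp (\<i> * complex_of_real (t \<bullet> y)) * complex_of_real (h y) \<partial>lborel)"

text \<open>
  Off \<open>L\<^sup>1\<close>, the transform of an \<open>L\<^sup>2\<close> function is the \<open>L\<^sup>2\<close> limit of the transforms of its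
  truncations to balls, determined up to a null set.
\<close>
definition fourier :: "(real ^ 'n \<Rightarrow> real) \<Rightarrow> real ^ 'n \<Rightarrow> complex" where
  "fourier h =
     (if integrable lborel h then fourier_integral h
      else (SOME g. g \<in> borel_measurable lborel \<and>
              (\<lambda>k. \<integral>\<^sup>+t. ennreal ((cmod (fourier_integral
                 (\<lambda>y. indicator (ball 0 (real k)) y * h y) t - g t))\<^sup>2) \<partial>lborel)
                \<longlonglongrightarrow> 0))"

definition sobolev_ellipsoid :: "real \<Rightarrow> real \<Rightarrow> (real ^ 'n \<Rightarrow> real) set" where
  "sobolev_ellipsoid \<alpha> L =
     {f \<in> borel_measurable lborel.
        integrable lborel (\<lambda>y. (f y)\<^sup>2) \<and>
        (\<integral>\<^sup>+t. ennreal ((1 + (norm t)\<^sup>2) powr \<alpha> * (cmod (fourier f t))\<^sup>2) \<partial>lborel) \<le> ennreal L}"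

definition prob_density :: "(real ^ 'n \<Rightarrow> real) \<Rightarrow> bool" where
  "prob_density f \<longleftrightarrow> (\<forall>y. 0 \<le> f y) \<and> integrable lborel f \<and> (\<integral>y. f y \<partial>lborel) = 1"

text \<open>
  For \<open>\<alpha> > d / 2\<close>, every density in the Sobolev ellipsoid has a unique continuous version; the
  classes below consist of these versions, so that point evaluation is meaningful.
\<close>
definition sobolev_densities :: "real \<Rightarrow> real \<Rightarrow> (real ^ 'n \<Rightarrow> real) set" where
  "sobolev_densities \<alpha> L =
     {f \<in> sobolev_ellipsoid \<alpha> L. prob_density f \<and> continuous_on UNIV f}"

subsection \<open>Observations, estimators and risk\<close>

definition radon_law :: "(real ^ 'n \<Rightarrow> real) \<Rightarrow> ((real ^ 'n) \<times> real) measure" where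
  "radon_law f =
     density (surface_measure \<Otimes>\<^sub>M lborel)
       (\<lambda>(s, u). ennreal (radon f s u / sphere_area CARD('n)))"

type_synonym 'n sample = "nat \<Rightarrow> (real ^ 'n) \<times> real"

definition estimator :: "nat \<Rightarrow> ('n::finite sample \<Rightarrow> real) \<Rightarrow> bool" where
  "estimator n T \<longleftrightarrow>
     T \<in> borel_measurable (\<Pi>\<^sub>M i\<in>{1..n}. (surface_measure :: (real ^ 'n) measure) \<Otimes>\<^sub>M lborel)"

text \<open>
  The risk is an extended nonnegative number: an infinite second moment counts as risk \<open>\<infinity>\<close>.
\<close>
definition mse ::
  "nat \<Rightarrow> ('n::finite sample \<Rightarrow> real) \<Rightarrow> real ^ 'n \<Rightarrow> (real ^ 'n \<Rightarrow> real) \<Rightarrow> ennreal" where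
  "mse n T x f = (\<integral>\<^sup>+\<omega>. ennreal (\<bar>T \<omega> - f x\<bar>\<^sup>2) \<partial>(\<Pi>\<^sub>M i\<in>{1..n}. radon_law f))"

subsection \<open>Consistency of the measure-theoretic conventions\<close>

lemma ex_orthonormal_basis_perp: "\<exists>B. orthonormal_basis_perp s B"
proof -
  obtain B where "pairwise orthogonal B" "\<And>b. b \<in> B \<Longrightarrow> norm b = 1"
    "span B = {v. v \<bullet> s = 0}"
    using orthonormal_basis_subspace[of "{v. v \<bullet> s = 0}"] subspace_hyperplane2[of s]
    by (metis (no_types, lifting))
  then show ?thesis
    by (auto simp: orthonormal_basis_perp_def)
qed

lemma emeasure_surface_measure:
  fixes A :: "(real ^ 'n) set"
  assumes "A \<in> sets borel" "A \<subseteq> sphere 0 1"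
  shows "emeasure surface_measure A =
           ennreal (real CARD('n)) * emeasure lborel {v \<in> cball 0 1 - {0}. v /\<^sub>R norm v \<in> A}"
proof -
  let ?D = "cball (0::real ^ 'n) 1 - {0}"
  let ?p = "\<lambda>v::real ^ 'n. v /\<^sub>R norm v"
  have p: "?p \<in> restrict_space lborel ?D \<rightarrow>\<^sub>M restrict_space borel (sphere 0 1)"
    by (rule measurable_restrict_space2)
       (auto simp: space_restrict_space intro!: measurable_restrict_space1)
  have "A \<in> sets (restrict_space borel (sphere 0 1))"
    using assms by (auto simp: sets_restrict_space_iff)
  then have "emeasure (distr (restrict_space lborel ?D) (restrict_space borel (sphere 0 1)) ?p) A
      = emeasure (restrict_space lborel ?D) (?p -` A \<inter> ?D)"
    using p by (subst emeasure_distr) (auto simp: space_restrict_space)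
  also have "\<dots> = emeasure lborel (?p -` A \<inter> ?D)"
    by (rule emeasure_restrict_space) auto
  also have "?p -` A \<inter> ?D = {v \<in> ?D. ?p v \<in> A}"
    by auto
  finally show ?thesis
    by (simp add: surface_measure_def)
qed

lemma emeasure_surface_measure_sphere:
  "emeasure surface_measure (sphere (0::real ^ 'n) 1) = ennreal (sphere_area CARD('n))"
proof -
  let ?d = "real CARD('n)"
  have "{v \<in> cball 0 1 - {0}. v /\<^sub>R norm v \<in> sphere (0::real ^ 'n) 1} = cball 0 1 - {0}"
    by auto
  then have "emeasure surface_measure (sphere (0::real ^ 'n) 1)
      = ennreal ?d * emeasure lborel (cball (0::real ^ 'n) 1 - {0})"
    by (simp add: emeasure_surface_measure)
  also have "emeasure lborel (cball (0::real ^ 'n) 1 - {0}) = emeasure lborel (cball (0::real ^ 'n) 1)"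
    by (rule emeasure_Diff_null_set) auto
  also have "\<dots> = ennreal (unit_ball_vol ?d)"
    by (simp add: emeasure_cball)
  also have "ennreal ?d * ennreal (unit_ball_vol ?d) = ennreal (?d * unit_ball_vol ?d)"
    by (simp add: ennreal_mult)
  also have "?d * unit_ball_vol ?d = sphere_area CARD('n)"
  proof -
    have "?d / 2 > 0" by simp
    then have "Gamma (?d / 2 + 1) = ?d / 2 * Gamma (?d / 2)"
      by (intro Gamma_plus1) (auto dest: nonpos_Ints_nonpos)
    then show ?thesis
      unfolding unit_ball_vol_def sphere_area_def by (simp only:) simp
  qed
  finally show ?thesis .
qed

end

theory Submission
  imports Defs "HOL-Real_Asymp.Real_Asymp"
begin

text \<open>
  The two-point argument of Brown and Low. If two models \<open>P\<^sub>0\<close>, \<open>P\<^sub>1\<close> have parameters at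
  distance \<open>\<Delta>\<close> and \<open>K\<close> bounds \<open>\<integral> (dP\<^sub>1/dP\<^sub>0)\<^sup>2 dP\<^sub>0\<close>, then every estimator satisfies
  \<open>5/8 \<Delta>\<^sup>2 \<le> R\<^sub>1 + 2 K R\<^sub>0\<close> for its risks \<open>R\<^sub>0\<close>, \<open>R\<^sub>1\<close>. Take for \<open>f\<^sub>0\<close> the density of \<open>N(x, I)\<close> and
  for \<open>f\<^sub>1\<close> the density of \<open>(1 - \<epsilon>) N(x, I) + \<epsilon> N(x, h\<^sup>2 I)\<close>. Both are densities for free, their
  Fourier transforms are explicit, and every Radon projection is the corresponding mixture of
  one-dimensional normal densities, so the likelihood ratio has second moment at most
  \<open>1 + \<epsilon>\<^sup>2/h\<close> per observation. With \<open>\<epsilon> = h powr (\<beta>' + d/2)\<close> the density \<open>f\<^sub>1\<close> stays in a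
  \<open>\<beta>'\<close>-ellipsoid whose radius does not depend on \<open>h\<close> and \<open>\<Delta>\<^sup>2\<close> is of order
  \<open>h powr (2 \<beta>' - d)\<close>. Choosing \<open>h powr (2 \<beta>' + d - 1) = \<kappa> ln n / n\<close> makes \<open>K \<le> n powr \<kappa>\<close>, and for
  small \<open>\<kappa>\<close> the fast rate assumed at \<open>f\<^sub>0\<close> absorbs \<open>K R\<^sub>0\<close>.
\<close>

subsection \<open>The constrained risk inequality\<close>

text \<open>Both sides agree on boxes, where the indicator and the product of densities factor
  together and the integral splits coordinatewise; sigma-finiteness makes boxes determine the
  measure. This turns an n-fold law under the alternative into a density over the n-fold law under
  the null.\<close>

lemma PiM_density:
  assumes "finite I" "product_sigma_finite M" "product_sigma_finite (\<lambda>i. density (M i) (r i))"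
    and [measurable]: "\<And>i. i \<in> I \<Longrightarrow> r i \<in> borel_measurable (M i)"
  shows "(\<Pi>\<^sub>M i\<in>I. density (M i) (r i)) = density (Pi\<^sub>M I M) (\<lambda>\<omega>. \<Prod>i\<in>I. r i (\<omega> i))"
proof -
  interpret M: product_sigma_finite M by fact
  interpret D: product_sigma_finite "\<lambda>i. density (M i) (r i)" by fact
  have [measurable]: "(\<lambda>\<omega>. r i (\<omega> i)) \<in> borel_measurable (Pi\<^sub>M I M)" if "i \<in> I" for i
    using that by measurable
  show ?thesis
  proof (rule D.PiM_eqI[symmetric])
    show "sets (density (Pi\<^sub>M I M) (\<lambda>\<omega>. \<Prod>i\<in>I. r i (\<omega> i))) = sets (\<Pi>\<^sub>M i\<in>I. density (M i) (r i))"
      by (simp cong: sets_PiM_cong)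
  next
    fix A assume A: "\<And>i. i \<in> I \<Longrightarrow> A i \<in> sets (density (M i) (r i))"
    then have [measurable]: "\<And>i. i \<in> I \<Longrightarrow> A i \<in> sets (M i)" by simp
    have PA: "Pi\<^sub>E I A \<in> sets (Pi\<^sub>M I M)"
      using A \<open>finite I\<close> by (intro sets_PiM_I_finite) auto
    have "emeasure (density (Pi\<^sub>M I M) (\<lambda>\<omega>. \<Prod>i\<in>I. r i (\<omega> i))) (Pi\<^sub>E I A)
        = (\<integral>\<^sup>+\<omega>. (\<Prod>i\<in>I. r i (\<omega> i)) * indicator (Pi\<^sub>E I A) \<omega> \<partial>Pi\<^sub>M I M)"
      by (intro emeasure_density PA) measurable
    also have "\<dots> = (\<integral>\<^sup>+\<omega>. (\<Prod>i\<in>I. r i (\<omega> i) * indicator (A i) (\<omega> i)) \<partial>Pi\<^sub>M I M)"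
    proof (rule nn_integral_cong)
      fix \<omega> assume "\<omega> \<in> space (Pi\<^sub>M I M)"
      then have "indicator (Pi\<^sub>E I A) \<omega> = (\<Prod>i\<in>I. indicator (A i) (\<omega> i) :: ennreal)"
        using \<open>finite I\<close>
        by (auto simp: space_PiM indicator_def PiE_iff prod_zero_iff)
      then show "(\<Prod>i\<in>I. r i (\<omega> i)) * indicator (Pi\<^sub>E I A) \<omega> = (\<Prod>i\<in>I. r i (\<omega> i) * indicator (A i) (\<omega> i))"
        by (simp add: prod.distrib)
    qed
    also have "\<dots> = (\<Prod>i\<in>I. \<integral>\<^sup>+x. r i x * indicator (A i) x \<partial>M i)"
      using \<open>finite I\<close> by (intro M.product_nn_integral_prod) measurable
    also have "\<dots> = (\<Prod>i\<in>I. emeasure (density (M i) (r i)) (A i))"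
      by (intro prod.cong refl emeasure_density[symmetric]) measurable
    finally show "emeasure (density (Pi\<^sub>M I M) (\<lambda>\<omega>. \<Prod>i\<in>I. r i (\<omega> i))) (Pi\<^sub>E I A)
        = (\<Prod>i\<in>I. emeasure (density (M i) (r i)) (A i))" .
  qed fact
qed

text \<open>\<open>M\<close> is the null law, \<open>r\<close> the likelihood ratio of the
  alternative. A pointwise quadratic bound is integrated against \<open>M\<close>: the two squared
  losses become the two risks, and the term in \<open>(r \<omega>)\<^sup>2\<close> costs at most 1/8
  of the squared distance because of \<open>K\<close>. The factor 5/8 is 3/4 - 1/8.\<close>

lemma constrained_risk_inequality:
  fixes r T :: "'a \<Rightarrow> real"
  assumes [measurable]: "r \<in> borel_measurable M" "T \<in> borel_measurable M"
    and r: "\<And>\<omega>. 0 \<le> r \<omega>" "(\<integral>\<^sup>+\<omega>. r \<omega> \<partial>M) = 1"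
    and K: "0 < K" "(\<integral>\<^sup>+\<omega>. (r \<omega>)\<^sup>2 \<partial>M) \<le> ennreal K"
  shows "ennreal (5 / 8 * (\<theta>\<^sub>1 - \<theta>\<^sub>0)\<^sup>2) \<le>
    (\<integral>\<^sup>+\<omega>. ennreal (\<bar>T \<omega> - \<theta>\<^sub>1\<bar>\<^sup>2) \<partial>density M r) +
    ennreal (2 * K) * (\<integral>\<^sup>+\<omega>. ennreal (\<bar>T \<omega> - \<theta>\<^sub>0\<bar>\<^sup>2) \<partial>M)" (is "_ \<le> ?R1 + _ * ?R0")
proof -
  let ?D = "\<theta>\<^sub>1 - \<theta>\<^sub>0"
  \<comment> \<open>AM-GM, twice; stated without square roots so that an infinite risk needs no separate treatment.\<close>
  have ptw: "3 / 4 * ?D\<^sup>2 * r \<omega> \<le>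
      r \<omega> * \<bar>T \<omega> - \<theta>\<^sub>1\<bar>\<^sup>2 + 2 * K * \<bar>T \<omega> - \<theta>\<^sub>0\<bar>\<^sup>2 + ?D\<^sup>2 / (8 * K) * (r \<omega>)\<^sup>2" for \<omega>
  proof -
    define a b where "a = T \<omega> - \<theta>\<^sub>1" and "b = T \<omega> - \<theta>\<^sub>0"
    have D: "?D = b - a" by (simp add: a_def b_def)
    have "0 \<le> r \<omega> * (?D / 2 + a)\<^sup>2" using r by simp
    \<comment> \<open>The weight \<open>2 * K\<close> gives \<open>(r \<omega>)\<^sup>2\<close> the
      coefficient \<open>?D\<^sup>2 / (8 * K)\<close>, from which the second moment bound later
      removes \<open>K\<close>.\<close>
    moreover have "0 \<le> 2 * K * (b - ?D * r \<omega> / (4 * K))\<^sup>2" using K by simp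
    moreover have "2 * K * (b - ?D * r \<omega> / (4 * K))\<^sup>2
        = 2 * K * b\<^sup>2 - ?D * b * r \<omega> + ?D\<^sup>2 / (8 * K) * (r \<omega>)\<^sup>2"
      using K by (simp add: power2_eq_square field_simps)
    moreover have "?D\<^sup>2 * r \<omega> = ?D * b * r \<omega> - ?D * a * r \<omega>"
      by (simp add: D power2_eq_square algebra_simps)
    moreover have "r \<omega> * (?D / 2 + a)\<^sup>2 = ?D\<^sup>2 * r \<omega> / 4 + ?D * a * r \<omega> + r \<omega> * a\<^sup>2"
      by (simp add: power2_eq_square field_simps)
    ultimately have "3 / 4 * ?D\<^sup>2 * r \<omega> \<le> r \<omega> * a\<^sup>2 + 2 * K * b\<^sup>2 + ?D\<^sup>2 / (8 * K) * (r \<omega>)\<^sup>2"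
      by linarith
    then show ?thesis by (simp only: power2_abs a_def b_def)
  qed
  have "ennreal (3 / 4 * ?D\<^sup>2) = ennreal (3 / 4 * ?D\<^sup>2) * (\<integral>\<^sup>+\<omega>. r \<omega> \<partial>M)"
    by (simp add: r)
  also have "\<dots> = (\<integral>\<^sup>+\<omega>. ennreal (3 / 4 * ?D\<^sup>2) * ennreal (r \<omega>) \<partial>M)"
    by (rule nn_integral_cmult[symmetric]) measurable
  also have "\<dots> = (\<integral>\<^sup>+\<omega>. ennreal (3 / 4 * ?D\<^sup>2 * r \<omega>) \<partial>M)"
    by (intro nn_integral_cong ennreal_mult'[symmetric]) simp
  also have "\<dots> \<le> (\<integral>\<^sup>+\<omega>. ennreal (r \<omega>) * ennreal (\<bar>T \<omega> - \<theta>\<^sub>1\<bar>\<^sup>2)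
      + ennreal (2 * K) * ennreal (\<bar>T \<omega> - \<theta>\<^sub>0\<bar>\<^sup>2) + ennreal (?D\<^sup>2 / (8 * K)) * ennreal ((r \<omega>)\<^sup>2) \<partial>M)"
  proof (rule nn_integral_mono)
    fix \<omega>
    show "ennreal (3 / 4 * ?D\<^sup>2 * r \<omega>) \<le> ennreal (r \<omega>) * ennreal (\<bar>T \<omega> - \<theta>\<^sub>1\<bar>\<^sup>2)
      + ennreal (2 * K) * ennreal (\<bar>T \<omega> - \<theta>\<^sub>0\<bar>\<^sup>2) + ennreal (?D\<^sup>2 / (8 * K)) * ennreal ((r \<omega>)\<^sup>2)"
    proof -
      have "ennreal (r \<omega> * a + 2 * K * b + c * d) = ennreal (r \<omega>) * ennreal a + ennreal (2 * K) * ennreal b + ennreal c * ennreal d"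
        if "0 \<le> a" "0 \<le> b" "0 \<le> c" "0 \<le> d" for a b c d
        using that r K by (simp add: ennreal_mult)
      from this[of "\<bar>T \<omega> - \<theta>\<^sub>1\<bar>\<^sup>2" "\<bar>T \<omega> - \<theta>\<^sub>0\<bar>\<^sup>2" "?D\<^sup>2 / (8 * K)" "(r \<omega>)\<^sup>2"]
      show ?thesis
        using ennreal_leI[OF ptw[of \<omega>]] K by simp
    qed
  qed
  also have "\<dots> = (\<integral>\<^sup>+\<omega>. ennreal (r \<omega>) * ennreal (\<bar>T \<omega> - \<theta>\<^sub>1\<bar>\<^sup>2) \<partial>M) + ennreal (2 * K) * ?R0
      + ennreal (?D\<^sup>2 / (8 * K)) * (\<integral>\<^sup>+\<omega>. (r \<omega>)\<^sup>2 \<partial>M)"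
    by (simp add: nn_integral_add nn_integral_cmult)
  also have "(\<integral>\<^sup>+\<omega>. ennreal (r \<omega>) * ennreal (\<bar>T \<omega> - \<theta>\<^sub>1\<bar>\<^sup>2) \<partial>M) = ?R1"
    by (rule nn_integral_density[symmetric]) measurable
  also have "ennreal (?D\<^sup>2 / (8 * K)) * (\<integral>\<^sup>+\<omega>. (r \<omega>)\<^sup>2 \<partial>M) \<le> ennreal (?D\<^sup>2 / (8 * K)) * ennreal K"
    using K by (intro mult_left_mono) auto
  also have "\<dots> = ennreal (?D\<^sup>2 / 8)"
    using K by (subst ennreal_mult[symmetric]) auto
  finally have *: "ennreal (3 / 4 * ?D\<^sup>2) \<le> (?R1 + ennreal (2 * K) * ?R0) + ennreal (?D\<^sup>2 / 8)"
    by (simp add: add_left_mono)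
  \<comment> \<open>In \<open>ennreal\<close> a common finite summand may be cancelled even if a
    risk is infinite, so the eighth is split off instead of subtracted.\<close>
  have split: "ennreal (3 / 4 * ?D\<^sup>2) = ennreal (5 / 8 * ?D\<^sup>2) + ennreal (?D\<^sup>2 / 8)"
    by (subst ennreal_plus[symmetric]) auto
  have "ennreal (?D\<^sup>2 / 8) + ennreal (5 / 8 * ?D\<^sup>2) \<le> ennreal (?D\<^sup>2 / 8) + (?R1 + ennreal (2 * K) * ?R0)"
    using * unfolding split by (simp only: add.commute)
  then show ?thesis
    by (simp only: ennreal_add_left_cancel_le) simp
qed

subsection \<open>Isotropic Gaussian densities and their transforms\<close>

text \<open>The density of N(x, h^2 I). Written through the norm it is visibly rotation invariant,
  hence factors along every orthonormal basis.\<close>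

definition gauss :: "real \<Rightarrow> 'a::euclidean_space \<Rightarrow> 'a \<Rightarrow> real" where
  "gauss h x v = exp (- (norm (v - x))\<^sup>2 / (2 * h\<^sup>2)) / (sqrt (2 * pi) * h) ^ DIM('a)"

text \<open>Pythagoras splits the squared norm in the exponent. The basis is arbitrary because
  \<open>hyperplane_measure\<close> rests on an unspecified one.\<close>

lemma gauss_orthonormal:
  fixes B :: "'a::euclidean_space set"
  assumes "finite B" "pairwise orthogonal B" "\<And>b. b \<in> B \<Longrightarrow> norm b = 1" "span B = UNIV" "0 < h"
  shows "gauss h x v = (\<Prod>b\<in>B. normal_density (x \<bullet> b) h (v \<bullet> b))"
proof -
  have "independent B"
    using assms(3) by (intro pairwise_orthogonal_independent assms) force
  then have card: "card B = DIM('a)"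
    using assms by (metis dim_UNIV dim_span_eq_card_independent)
  have "v - x = (\<Sum>b\<in>B. ((v - x) \<bullet> b) *\<^sub>R b)"
    using assms by (intro orthonormal_basis_expand[symmetric]) auto
  then have "(norm (v - x))\<^sup>2 = (norm (\<Sum>b\<in>B. ((v - x) \<bullet> b) *\<^sub>R b))\<^sup>2" by simp
  also have "\<dots> = (\<Sum>b\<in>B. (norm (((v - x) \<bullet> b) *\<^sub>R b))\<^sup>2)"
    using assms by (intro norm_sum_Pythagorean) (auto simp: pairwise_def orthogonal_def)
  also have "\<dots> = (\<Sum>b\<in>B. (v \<bullet> b - x \<bullet> b)\<^sup>2)"
    using assms by (intro sum.cong) (auto simp: inner_diff_left)
  finally have "exp (- (norm (v - x))\<^sup>2 / (2 * h\<^sup>2)) = (\<Prod>b\<in>B. exp (- (v \<bullet> b - x \<bullet> b)\<^sup>2 / (2 * h\<^sup>2)))"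
    using assms by (simp add: exp_sum[symmetric] sum_negf sum_divide_distrib)
  then show ?thesis
    using assms by (simp add: gauss_def normal_density_def prod_dividef card real_sqrt_mult)
qed

lemma gauss_Basis: "0 < h \<Longrightarrow> gauss h x v = (\<Prod>b\<in>Basis. normal_density (x \<bullet> b) h (v \<bullet> b))"
  by (rule gauss_orthonormal) (auto simp: pairwise_def orthogonal_def inner_Basis)

lemma gauss_nonneg [simp]: "0 \<le> h \<Longrightarrow> 0 \<le> gauss h x v"
  by (simp add: gauss_def)

lemma gauss_center: "gauss h x x = 1 / (sqrt (2 * pi) * h) ^ DIM('a)" for x :: "'a::euclidean_space"
  by (simp add: gauss_def)

lemma gauss_le: "0 < h \<Longrightarrow> gauss h x v \<le> gauss h x x"
  by (auto simp: gauss_def intro!: divide_right_mono)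

lemma continuous_on_gauss: "continuous_on A (gauss h x)"
  unfolding gauss_def[abs_def]
  by (cases "h = 0") (auto intro!: continuous_intros)

lemma measurable_gauss [measurable]: "gauss h x \<in> borel_measurable borel"
  by (intro borel_measurable_continuous_onI continuous_on_gauss)

text \<open>Lebesgue measure is the image of the product measure on coordinates, so Fubini applies.
  The codomain is a general field to serve both real densities and complex Fourier
  integrands.\<close>

lemma
  fixes f :: "'a::euclidean_space \<Rightarrow> real \<Rightarrow> 'b::{real_normed_field,banach,second_countable_topology}"
  assumes "\<And>b. b \<in> Basis \<Longrightarrow> integrable lborel (f b)"
  shows integrable_lborel_prod_Basis: "integrable lborel (\<lambda>v::'a. \<Prod>b\<in>Basis. f b (v \<bullet> b))"
    and integral_lborel_prod_Basis:
      "(\<integral>v. (\<Prod>b\<in>Basis. f b (v \<bullet> b)) \<partial>(lborel :: 'a measure)) = (\<Prod>b\<in>Basis. \<integral>u. f b u \<partial>lborel)"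
proof -
  interpret product_sigma_finite "\<lambda>_::'a. lborel :: real measure" ..
  have lb: "(lborel :: 'a measure) = distr (\<Pi>\<^sub>M b\<in>Basis. lborel) borel (\<lambda>g. \<Sum>b\<in>Basis. g b *\<^sub>R b)"
    by (rule lborel_eq)
  have [measurable]: "f b \<in> borel_measurable borel" if "b \<in> Basis" for b
    using assms[OF that] by auto
  have *: "(\<Prod>b\<in>Basis. f b ((\<Sum>b\<in>Basis. g b *\<^sub>R b) \<bullet> b)) = (\<Prod>b\<in>Basis. f b (g b))" for g :: "'a \<Rightarrow> real"
    by (intro prod.cong) auto
  have m: "(\<lambda>v::'a. \<Prod>b\<in>Basis. f b (v \<bullet> b)) \<in> borel_measurable borel" by measurable
  show "integrable lborel (\<lambda>v::'a. \<Prod>b\<in>Basis. f b (v \<bullet> b))"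
    unfolding lb using assms m
    by (subst integrable_distr_eq) (auto simp: * intro!: product_integrable_prod)
  show "(\<integral>v. (\<Prod>b\<in>Basis. f b (v \<bullet> b)) \<partial>(lborel :: 'a measure)) = (\<Prod>b\<in>Basis. \<integral>u. f b u \<partial>lborel)"
    unfolding lb using assms m
    by (subst integral_distr) (auto simp: * intro!: product_integral_prod)
qed

lemma
  assumes "0 < h"
  shows integrable_gauss: "integrable lborel (gauss h x)"
    and integral_gauss: "(\<integral>v. gauss h x v \<partial>lborel) = 1"
proof -
  have g: "gauss h x = (\<lambda>v. \<Prod>b\<in>Basis. normal_density (x \<bullet> b) h (v \<bullet> b))"
    using gauss_Basis[OF assms] by blast
  show "integrable lborel (gauss h x)"
    unfolding g using assms by (intro integrable_lborel_prod_Basis) auto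
  show "(\<integral>v. gauss h x v \<partial>lborel) = 1"
    unfolding g using assms by (subst integral_lborel_prod_Basis) auto
qed

text \<open>The substitution \<mu> + \<sigma> u reduces the integral to the characteristic function
  of the standard normal distribution.\<close>

lemma char_normal_density:
  assumes "0 < \<sigma>"
  shows "(\<integral>u. iexp (t * u) * complex_of_real (normal_density \<mu> \<sigma> u) \<partial>lborel)
    = iexp (t * \<mu>) * complex_of_real (exp (- (\<sigma> * t)\<^sup>2 / 2))"
proof -
  have eq: "normal_density \<mu> \<sigma> (\<mu> + \<sigma> * u) = std_normal_density u / \<sigma>" for u
    using assms by (simp add: normal_density_def real_sqrt_mult power_mult_distrib field_simps)
  have "(\<integral>u. iexp (t * u) * complex_of_real (normal_density \<mu> \<sigma> u) \<partial>lborel)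
     = \<sigma> *\<^sub>R (\<integral>u. iexp (t * (\<mu> + \<sigma> * u)) * complex_of_real (normal_density \<mu> \<sigma> (\<mu> + \<sigma> * u)) \<partial>lborel)"
    using assms by (subst lborel_integral_real_affine[where c=\<sigma> and t=\<mu>]) auto
  also have "\<dots> = \<sigma> *\<^sub>R (\<integral>u. (iexp (t * \<mu>) / \<sigma>) * (std_normal_density u *\<^sub>R iexp ((\<sigma> * t) * u)) \<partial>lborel)"
    unfolding eq
    by (intro arg_cong[where f="\<lambda>x. \<sigma> *\<^sub>R x"] Bochner_Integration.integral_cong refl)
       (simp add: exp_add[symmetric] scaleR_conv_of_real algebra_simps)
  also have "\<dots> = \<sigma> *\<^sub>R ((iexp (t * \<mu>) / \<sigma>) * (\<integral>u. std_normal_density u *\<^sub>R iexp ((\<sigma> * t) * u) \<partial>lborel))"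
    by (simp only: Bochner_Integration.integral_mult_right_zero)
  also have "(\<integral>u. std_normal_density u *\<^sub>R iexp ((\<sigma> * t) * u) \<partial>lborel) = char std_normal_distribution (\<sigma> * t)"
    unfolding char_def by (subst integral_density) (auto simp: normal_density_nonneg)
  finally show ?thesis
    using assms by (simp add: char_std_normal_distribution scaleR_conv_of_real)
qed

text \<open>Kernel and density both factor over coordinates. The centre enters only through a phase
  of modulus one, so Sobolev norms will not depend on \<open>x\<close>.\<close>

lemma fourier_integral_gauss:
  fixes x t :: "real ^ 'n"
  assumes "0 < h"
  shows "fourier_integral (gauss h x) t = iexp (t \<bullet> x) * complex_of_real (exp (- (h * norm t)\<^sup>2 / 2))"
proof -
  have "exp (\<i> * complex_of_real (t \<bullet> y)) * complex_of_real (gauss h x y)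
      = (\<Prod>b\<in>Basis. iexp ((t \<bullet> b) * (y \<bullet> b)) * complex_of_real (normal_density (x \<bullet> b) h (y \<bullet> b)))" for y
    by (simp add: gauss_Basis[OF assms] prod.distrib exp_sum[symmetric] sum_distrib_left[symmetric]
        flip: of_real_sum of_real_prod of_real_mult)
      (simp add: euclidean_inner[of t y])
  then have "fourier_integral (gauss h x) t =
      (\<integral>y. (\<Prod>b\<in>Basis. iexp ((t \<bullet> b) * (y \<bullet> b)) * complex_of_real (normal_density (x \<bullet> b) h (y \<bullet> b))) \<partial>lborel)"
    by (simp add: fourier_integral_def)
  also have "\<dots> = (\<Prod>b\<in>Basis. \<integral>u. iexp ((t \<bullet> b) * u) * complex_of_real (normal_density (x \<bullet> b) h u) \<partial>lborel)"
  proof (rule integral_lborel_prod_Basis)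
    fix b :: "real ^ 'n"
    have "integrable lborel (\<lambda>u. complex_of_real (normal_density (x \<bullet> b) h u))"
      using assms by simp
    then show "integrable lborel (\<lambda>u. iexp ((t \<bullet> b) * u) * complex_of_real (normal_density (x \<bullet> b) h u))"
      by (rule Bochner_Integration.integrable_bound) (auto simp: norm_mult)
  qed
  also have "\<dots> = (\<Prod>b\<in>Basis. iexp ((t \<bullet> b) * (x \<bullet> b)) * complex_of_real (exp (- (h * (t \<bullet> b))\<^sup>2 / 2)))"
    by (simp only: char_normal_density[OF assms])
  also have "\<dots> = iexp (t \<bullet> x) * complex_of_real (exp (\<Sum>b\<in>Basis. - (h * (t \<bullet> b))\<^sup>2 / 2))"
    by (simp add: prod.distrib exp_sum flip: sum_distrib_left of_real_sum of_real_prod of_real_mult)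
      (simp add: euclidean_inner[of t x] exp_sum sum_distrib_left)
  also have "(\<Sum>b\<in>Basis. - (h * (t \<bullet> b))\<^sup>2 / 2) = - (h * norm t)\<^sup>2 / 2"
  proof -
    have "(norm t)\<^sup>2 = (\<Sum>b\<in>Basis. (t \<bullet> b)\<^sup>2)"
      unfolding power2_norm_eq_inner euclidean_inner[of t t] by (simp add: power2_eq_square)
    then show ?thesis
      by (simp add: power_mult_distrib sum_negf sum_divide_distrib sum_distrib_left)
  qed
  finally show ?thesis .
qed

text \<open>Adjoining \<open>s\<close> to the chosen basis \<open>B\<close> of its orthogonal
  complement gives an orthonormal basis of the whole space. On the hyperplane the factor for
  \<open>s\<close> is constant, and each remaining factor integrates to one; this works for
  whichever \<open>B\<close> was chosen.\<close>

lemma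
  fixes x s :: "real ^ 'n"
  assumes "norm s = 1" "0 < h"
  shows integrable_hyperplane_gauss: "integrable (hyperplane_measure s u) (gauss h x)"
    and radon_gauss: "radon (gauss h x) s u = normal_density (x \<bullet> s) h u"
proof -
  define B where "B = (SOME B. orthonormal_basis_perp s B)"
  have B: "pairwise orthogonal B" "\<And>b. b \<in> B \<Longrightarrow> norm b = 1" "span B = {v. v \<bullet> s = 0}"
    using someI_ex[OF ex_orthonormal_basis_perp[of s]] by (auto simp: B_def orthonormal_basis_perp_def)
  have perp: "b \<bullet> s = 0" if "b \<in> B" for b
    using B(3) span_base[OF that] by auto
  have "s \<notin> B" using perp[of s] assms(1) by (auto simp: norm_eq_1)
  have "independent B"
    using B by (intro pairwise_orthogonal_independent) force+
  then have fin: "finite B" by (rule independent_imp_finite)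
  have ons: "pairwise orthogonal (insert s B)" "\<And>b. b \<in> insert s B \<Longrightarrow> norm b = 1"
    using B(1,2) assms(1) perp by (auto simp: pairwise_insert orthogonal_def inner_commute)
  have "span (insert s B) = UNIV"
  proof -
    have "v - (v \<bullet> s) *\<^sub>R s \<in> span B" for v
      using assms(1) by (simp add: B(3) inner_diff_left norm_eq_1)
    then show ?thesis
      by (auto simp: span_insert)
  qed
  note g = gauss_orthonormal[OF _ ons this \<open>0 < h\<close>]
  interpret product_sigma_finite "\<lambda>_::real ^ 'n. lborel :: real measure" ..
  have hyp: "hyperplane_measure s u =
      distr (Pi\<^sub>M B (\<lambda>_. lborel)) borel (\<lambda>g. u *\<^sub>R s + (\<Sum>b\<in>B. g b *\<^sub>R b))"
    by (simp add: hyperplane_measure_def B_def Let_def)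
  have eq: "gauss h x (u *\<^sub>R s + (\<Sum>b\<in>B. g b *\<^sub>R b)) =
      normal_density (x \<bullet> s) h u * (\<Prod>b\<in>B. normal_density (x \<bullet> b) h (g b))" for g
  proof -
    let ?v = "u *\<^sub>R s + (\<Sum>b\<in>B. g b *\<^sub>R b)"
    have "?v \<bullet> s = u"
      using assms(1) perp by (simp add: inner_add_left inner_sum_left norm_eq_1)
    moreover have "?v \<bullet> b = g b" if "b \<in> B" for b
    proof -
      have "(\<Sum>b'\<in>B. g b' *\<^sub>R b') \<bullet> b = (\<Sum>b'\<in>B. if b' = b then g b else 0)"
        unfolding inner_sum_left
        using B(1,2) that by (intro sum.cong) (auto simp: pairwise_def orthogonal_def norm_eq_1)
      then show ?thesis
        using fin that perp[OF that] by (simp add: inner_add_left inner_commute[of s])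
    qed
    moreover have "gauss h x ?v = (\<Prod>b\<in>insert s B. normal_density (x \<bullet> b) h (?v \<bullet> b))"
      using fin by (intro g) auto
    ultimately show ?thesis
      using fin \<open>s \<notin> B\<close> by (auto intro!: prod.cong)
  qed
  have [measurable]: "(\<lambda>g. u *\<^sub>R s + (\<Sum>b\<in>B. g b *\<^sub>R b)) \<in> Pi\<^sub>M B (\<lambda>_. lborel) \<rightarrow>\<^sub>M borel"
    by measurable
  show "integrable (hyperplane_measure s u) (gauss h x)"
    unfolding hyp using fin assms(2)
    by (subst integrable_distr_eq) (auto simp: eq intro!: integrable_mult_right product_integrable_prod)
  have "(\<integral>g. (\<Prod>b\<in>B. normal_density (x \<bullet> b) h (g b)) \<partial>Pi\<^sub>M B (\<lambda>_. lborel)) = 1"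
    using fin assms(2) by (subst product_integral_prod) auto
  then show "radon (gauss h x) s u = normal_density (x \<bullet> s) h u"
    unfolding radon_def hyp by (subst integral_distr) (auto simp: eq)
qed

subsection \<open>Gaussian mixtures in Sobolev ellipsoids\<close>

text \<open>Both hypotheses of the two-point argument lie in this family:
  \<open>mixture 0 1 x\<close> is N(x, I), and a small \<open>h\<close> concentrates mass \<epsilon>
  near \<open>x\<close>.\<close>

definition mixture :: "real \<Rightarrow> real \<Rightarrow> real ^ 'n \<Rightarrow> real ^ 'n \<Rightarrow> real" where
  "mixture \<epsilon> h x v = (1 - \<epsilon>) * gauss 1 x v + \<epsilon> * gauss h x v"

definition normal_mixture :: "real \<Rightarrow> real \<Rightarrow> real \<Rightarrow> real \<Rightarrow> real" where
  "normal_mixture \<epsilon> h \<mu> u = (1 - \<epsilon>) * normal_density \<mu> 1 u + \<epsilon> * normal_density \<mu> h u"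

section \<open>Mass, projections and Fourier transform of the mixture\<close>

lemma integrable_mixture: "0 < h \<Longrightarrow> integrable lborel (mixture \<epsilon> h x)"
  unfolding mixture_def[abs_def]
  by (intro Bochner_Integration.integrable_add integrable_mult_right integrable_gauss) auto

lemma integral_mixture: "0 < h \<Longrightarrow> (\<integral>v. mixture \<epsilon> h x v \<partial>lborel) = 1"
  unfolding mixture_def
  by (subst Bochner_Integration.integral_add) (auto simp: integral_gauss intro!: integrable_mult_right integrable_gauss)

lemma radon_mixture:
  assumes "norm s = 1" "0 < h"
  shows "radon (mixture \<epsilon> h x) s u = normal_mixture \<epsilon> h (x \<bullet> s) u"
proof -
  have "radon (mixture \<epsilon> h x) s u = (1 - \<epsilon>) * radon (gauss 1 x) s u + \<epsilon> * radon (gauss h x) s u"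
    unfolding radon_def mixture_def using assms
    by (subst Bochner_Integration.integral_add) (auto intro!: integrable_mult_right integrable_hyperplane_gauss)
  then show ?thesis
    using assms by (simp add: radon_gauss normal_mixture_def)
qed

lemma fourier_mixture:
  assumes "0 < h"
  shows "fourier (mixture \<epsilon> h x) t =
    iexp (t \<bullet> x) * complex_of_real ((1 - \<epsilon>) * exp (- (norm t)\<^sup>2 / 2) + \<epsilon> * exp (- (h * norm t)\<^sup>2 / 2))"
proof -
  have int: "integrable lborel (\<lambda>y. exp (\<i> * complex_of_real (t \<bullet> y)) * complex_of_real (gauss h x y))"
    if "0 < h" for h
    using integrable_of_real[OF integrable_gauss[OF that, of x], where 'a=complex]
    by (rule Bochner_Integration.integrable_bound) (auto simp: norm_mult)
  \<comment> \<open>Integrability selects the first branch of \<open>fourier\<close>, so no L^2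
    limit has to be identified.\<close>
  have "fourier (mixture \<epsilon> h x) t = fourier_integral (mixture \<epsilon> h x) t"
    using integrable_mixture[OF assms, of \<epsilon> x] by (simp add: fourier_def)
  also have "\<dots> = (\<integral>y. complex_of_real (1 - \<epsilon>) * (exp (\<i> * complex_of_real (t \<bullet> y)) * complex_of_real (gauss 1 x y)) +
      complex_of_real \<epsilon> * (exp (\<i> * complex_of_real (t \<bullet> y)) * complex_of_real (gauss h x y)) \<partial>lborel)"
    unfolding fourier_integral_def mixture_def
    by (intro Bochner_Integration.integral_cong refl) (simp add: algebra_simps)
  also have "\<dots> = complex_of_real (1 - \<epsilon>) * fourier_integral (gauss 1 x) t + complex_of_real \<epsilon> * fourier_integral (gauss h x) t"
    unfolding fourier_integral_def using int[of 1] int[OF assms]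
    by (subst Bochner_Integration.integral_add) auto
  finally show ?thesis
    using assms by (simp add: fourier_integral_gauss algebra_simps)
qed

text \<open>The squared Sobolev norm of \<open>gauss 1 x\<close>, for any centre. The type argument
  only fixes the dimension.\<close>

definition sobolev_mass :: "'n::finite itself \<Rightarrow> real \<Rightarrow> ennreal" where
  "sobolev_mass _ \<alpha> = (\<integral>\<^sup>+t. ennreal ((1 + (norm t)\<^sup>2) powr \<alpha> * exp (- (norm t)\<^sup>2)) \<partial>(lborel :: (real ^ 'n) measure))"

lemma sobolev_mass_finite:
  assumes "0 < \<alpha>"
  shows "sobolev_mass TYPE('n::finite) \<alpha> < \<infinity>"
proof -
  define c where "c = exp (1 / 2 + \<alpha> * ln (2 * \<alpha>)) * sqrt (2 * pi) ^ CARD('n)"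
  have "sobolev_mass TYPE('n::finite) \<alpha> \<le> (\<integral>\<^sup>+t. ennreal c * ennreal (gauss 1 0 t) \<partial>(lborel :: (real ^ 'n) measure))"
    unfolding sobolev_mass_def
  proof (rule nn_integral_mono)
    fix t :: "real ^ 'n"
    define z where "z = 1 + (norm t)\<^sup>2"
    have "0 < z" by (simp add: z_def add_pos_nonneg)
    \<comment> \<open>Scaling by \<open>2 * \<alpha>\<close> leaves exactly \<open>z / 2\<close> in
      the exponent, half of the Gaussian decay; the other half is an integrable Gaussian.\<close>
    have "ln (z / (2 * \<alpha>)) \<le> z / (2 * \<alpha>) - 1"
      using \<open>0 < z\<close> assms by (intro ln_le_minus_one) simp
    then have "\<alpha> * ln z \<le> \<alpha> * (z / (2 * \<alpha>) + ln (2 * \<alpha>))"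
      using \<open>0 < z\<close> assms by (intro mult_left_mono) (auto simp: ln_div)
    also have "\<dots> = z / 2 + \<alpha> * ln (2 * \<alpha>)"
      using assms by (simp add: field_simps)
    finally have "z powr \<alpha> \<le> exp (z / 2 + \<alpha> * ln (2 * \<alpha>))"
      using \<open>0 < z\<close> by (simp add: powr_def)
    then have "z powr \<alpha> * exp (- (norm t)\<^sup>2) \<le> exp (z / 2 + \<alpha> * ln (2 * \<alpha>)) * exp (- (norm t)\<^sup>2)"
      by (intro mult_right_mono) auto
    also have "\<dots> = exp (1 / 2 + \<alpha> * ln (2 * \<alpha>)) * exp (- (norm t)\<^sup>2 / 2)"
      by (simp add: z_def field_simps flip: exp_add)
    also have "\<dots> = c * gauss 1 0 t"
      by (simp add: c_def gauss_def)
    finally show "ennreal ((1 + (norm t)\<^sup>2) powr \<alpha> * exp (- (norm t)\<^sup>2)) \<le> ennreal c * ennreal (gauss 1 0 t)"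
      by (subst ennreal_mult[symmetric]) (auto simp: z_def c_def intro!: ennreal_leI)
  qed
  also have "\<dots> = ennreal c"
    using nn_integral_eq_integral[OF integrable_gauss[of 1 "0 :: real ^ 'n"]]
    by (subst nn_integral_cmult) (auto simp: integral_gauss)
  finally show ?thesis by (auto simp: less_top intro: le_less_trans)
qed

text \<open>Substituting t / h costs the Jacobian h^(-d) and, since h is at most 1, a factor of at
  most h^(-2 \<alpha>) from the weight. The left side is the squared Sobolev norm of
  \<open>gauss h x\<close>.\<close>

lemma sobolev_mass_scaled:
  assumes "0 < h" "h \<le> 1" "0 \<le> \<alpha>"
  shows "(\<integral>\<^sup>+t. ennreal ((1 + (norm t)\<^sup>2) powr \<alpha> * exp (- (h * norm t)\<^sup>2)) \<partial>(lborel :: (real ^ 'n) measure))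
    \<le> ennreal (h powr (- 2 * \<alpha> - real CARD('n))) * sobolev_mass TYPE('n) \<alpha>"
proof -
  let ?f = "\<lambda>t :: real ^ 'n. ennreal ((1 + (norm t)\<^sup>2) powr \<alpha> * exp (- (h * norm t)\<^sup>2))"
  have "integral\<^sup>N lborel ?f =
     (\<integral>\<^sup>+t. ?f t \<partial>density (distr lborel borel (\<lambda>x. 0 + (1 / h) *\<^sub>R x)) (\<lambda>_. \<bar>1 / h\<bar>^DIM(real ^ 'n)))"
    using assms by (subst lborel_affine[of "1 / h" 0]) auto
  also have "\<dots> = ennreal ((1 / h) ^ CARD('n)) * (\<integral>\<^sup>+t. ?f ((1 / h) *\<^sub>R t) \<partial>lborel)"
    using assms by (subst nn_integral_density) (auto simp: nn_integral_distr nn_integral_cmult)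
  also have "(\<integral>\<^sup>+t. ?f ((1 / h) *\<^sub>R t) \<partial>lborel)
     \<le> (\<integral>\<^sup>+t. ennreal (h powr (- 2 * \<alpha>)) * ennreal ((1 + (norm t)\<^sup>2) powr \<alpha> * exp (- (norm t)\<^sup>2)) \<partial>(lborel :: (real ^ 'n) measure))"
  proof (rule nn_integral_mono)
    fix t :: "real ^ 'n"
    have "1 + (norm t / h)\<^sup>2 \<le> (1 + (norm t)\<^sup>2) / h\<^sup>2"
    proof -
      have "1 \<le> 1 / h\<^sup>2" using assms by (simp add: power_le_one)
      then show ?thesis by (simp add: add_divide_distrib power_divide)
    qed
    then have "(1 + (norm t / h)\<^sup>2) powr \<alpha> \<le> ((1 + (norm t)\<^sup>2) / h\<^sup>2) powr \<alpha>"
      using assms by (intro powr_mono2) auto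
    also have "\<dots> = h powr (- 2 * \<alpha>) * (1 + (norm t)\<^sup>2) powr \<alpha>"
      using assms by (simp add: powr_divide powr_minus_divide powr_powr flip: powr_numeral)
    finally show "?f ((1 / h) *\<^sub>R t) \<le> ennreal (h powr (- 2 * \<alpha>)) * ennreal ((1 + (norm t)\<^sup>2) powr \<alpha> * exp (- (norm t)\<^sup>2))"
      using assms by (subst ennreal_mult[symmetric]) (auto intro!: ennreal_leI mult_right_mono simp flip: mult.assoc)
  qed
  also have "\<dots> = ennreal (h powr (- 2 * \<alpha>)) * sobolev_mass TYPE('n) \<alpha>"
    unfolding sobolev_mass_def by (rule nn_integral_cmult) measurable
  also have "ennreal ((1 / h) ^ CARD('n)) * (ennreal (h powr (- 2 * \<alpha>)) * sobolev_mass TYPE('n) \<alpha>)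
     = ennreal (h powr (- 2 * \<alpha> - real CARD('n))) * sobolev_mass TYPE('n) \<alpha>"
    using assms unfolding mult.assoc[symmetric]
    by (subst ennreal_mult[symmetric]) (auto simp: powr_diff powr_realpow power_one_over power_inverse divide_inverse mult.commute)
  finally show ?thesis by (simp add: mult_left_mono)
qed

text \<open>The bound on \<epsilon> makes \<epsilon>^2 cancel the growth of the Sobolev norm of the
  narrow component, so each component contributes at most twice the mass at \<alpha>. That mass
  increases with the exponent; measuring the radius at \<beta> therefore gives one \<open>L\<close>
  for all \<alpha> up to \<beta>.\<close>

lemma mixture_in_sobolev_densities:
  fixes x :: "real ^ 'n"
  assumes "0 < h" "h \<le> 1" "0 \<le> \<epsilon>" "\<epsilon> \<le> 1" "\<epsilon> \<le> h powr (\<alpha> + real CARD('n) / 2)"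
    and "0 \<le> \<alpha>" "\<alpha> \<le> \<beta>" and L: "4 * sobolev_mass TYPE('n) \<beta> \<le> ennreal L"
  shows "mixture \<epsilon> h x \<in> sobolev_densities \<alpha> L"
proof -
  have cont: "continuous_on UNIV (mixture \<epsilon> h x)"
    unfolding mixture_def[abs_def] by (intro continuous_intros continuous_on_gauss)
  then have meas [measurable]: "mixture \<epsilon> h x \<in> borel_measurable borel"
    by (rule borel_measurable_continuous_onI)
  have int: "integrable lborel (mixture \<epsilon> h x)"
    using assms by (intro integrable_mixture)
  have nonneg: "0 \<le> mixture \<epsilon> h x v" for v
    using assms by (auto simp: mixture_def intro!: add_nonneg_nonneg)
  \<comment> \<open>Boundedness by the peak dominates the square by a multiple of the integrable
    mixture itself.\<close>
  have le: "mixture \<epsilon> h x v \<le> mixture \<epsilon> h x x" for v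
    unfolding mixture_def using assms by (intro add_mono mult_left_mono gauss_le) auto
  have "prob_density (mixture \<epsilon> h x)"
    unfolding prob_density_def using nonneg int assms(1)
    by (auto simp: integral_mixture)
  moreover have "integrable lborel (\<lambda>y. (mixture \<epsilon> h x y)\<^sup>2)"
    using integrable_mult_right[OF int, of "mixture \<epsilon> h x x"]
    by (rule Bochner_Integration.integrable_bound)
       (auto simp: power2_eq_square nonneg le intro!: mult_right_mono AE_I2)
  moreover have "(\<integral>\<^sup>+t. ennreal ((1 + (norm t)\<^sup>2) powr \<alpha> * (cmod (fourier (mixture \<epsilon> h x) t))\<^sup>2) \<partial>lborel) \<le> ennreal L"
  proof -
    have "(\<integral>\<^sup>+t. ennreal ((1 + (norm t)\<^sup>2) powr \<alpha> * (cmod (fourier (mixture \<epsilon> h x) t))\<^sup>2) \<partial>lborel)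
      \<le> (\<integral>\<^sup>+t. 2 * ennreal ((1 + (norm t)\<^sup>2) powr \<alpha> * exp (- (1 * norm t)\<^sup>2)) +
          2 * (ennreal (\<epsilon>\<^sup>2) * ennreal ((1 + (norm t)\<^sup>2) powr \<alpha> * exp (- (h * norm t)\<^sup>2))) \<partial>(lborel :: (real ^ 'n) measure))"
    proof (rule nn_integral_mono)
      fix t :: "real ^ 'n"
      define a b w where "a = exp (- (norm t)\<^sup>2 / 2)" and "b = exp (- (h * norm t)\<^sup>2 / 2)"
        and "w = (1 + (norm t)\<^sup>2) powr \<alpha>"
      have ab: "a\<^sup>2 = exp (- (norm t)\<^sup>2)" "b\<^sup>2 = exp (- (h * norm t)\<^sup>2)" "0 \<le> w"
        unfolding a_def b_def w_def by (simp_all flip: exp_double)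
      have "((1 - \<epsilon>) * a + \<epsilon> * b)\<^sup>2 \<le> 2 * ((1 - \<epsilon>) * a)\<^sup>2 + 2 * (\<epsilon> * b)\<^sup>2"
        using zero_le_power2[of "(1 - \<epsilon>) * a - \<epsilon> * b"] by (simp add: power2_eq_square algebra_simps)
      also have "((1 - \<epsilon>) * a)\<^sup>2 \<le> a\<^sup>2"
        using assms by (auto simp: power_mult_distrib power_le_one mult_left_le_one_le)
      finally have "w * ((1 - \<epsilon>) * a + \<epsilon> * b)\<^sup>2 \<le> w * (2 * a\<^sup>2 + 2 * (\<epsilon>\<^sup>2 * b\<^sup>2))"
        using ab by (intro mult_left_mono) (auto simp: power_mult_distrib)
      also have "\<dots> = 2 * (w * a\<^sup>2) + 2 * (\<epsilon>\<^sup>2 * (w * b\<^sup>2))" by (simp add: algebra_simps)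
      finally have *: "ennreal (w * ((1 - \<epsilon>) * a + \<epsilon> * b)\<^sup>2)
          \<le> 2 * ennreal (w * a\<^sup>2) + 2 * (ennreal (\<epsilon>\<^sup>2) * ennreal (w * b\<^sup>2))"
        using ab by (subst (asm) ennreal_le_iff[symmetric]) (auto simp: ennreal_plus ennreal_mult)
      have "cmod (fourier (mixture \<epsilon> h x) t) = \<bar>(1 - \<epsilon>) * a + \<epsilon> * b\<bar>"
        unfolding fourier_mixture[OF assms(1)] norm_mult norm_of_real a_def b_def by simp
      then show "ennreal ((1 + (norm t)\<^sup>2) powr \<alpha> * (cmod (fourier (mixture \<epsilon> h x) t))\<^sup>2) \<le>
          2 * ennreal ((1 + (norm t)\<^sup>2) powr \<alpha> * exp (- (1 * norm t)\<^sup>2)) +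
          2 * (ennreal (\<epsilon>\<^sup>2) * ennreal ((1 + (norm t)\<^sup>2) powr \<alpha> * exp (- (h * norm t)\<^sup>2)))"
        using * by (simp add: ab w_def)
    qed
    also have "\<dots> = 2 * sobolev_mass TYPE('n) \<alpha> + 2 * (ennreal (\<epsilon>\<^sup>2) *
        (\<integral>\<^sup>+t. ennreal ((1 + (norm t)\<^sup>2) powr \<alpha> * exp (- (h * norm t)\<^sup>2)) \<partial>(lborel :: (real ^ 'n) measure)))"
      by (subst nn_integral_add) (auto simp: nn_integral_cmult sobolev_mass_def)
    also have "\<dots> \<le> 2 * sobolev_mass TYPE('n) \<alpha> + 2 * (ennreal (\<epsilon>\<^sup>2) *
        (ennreal (h powr (- 2 * \<alpha> - real CARD('n))) * sobolev_mass TYPE('n) \<alpha>))"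
      using assms by (intro add_left_mono mult_left_mono sobolev_mass_scaled) auto
    also have "\<dots> \<le> 2 * sobolev_mass TYPE('n) \<alpha> + 2 * sobolev_mass TYPE('n) \<alpha>"
    proof -
      have "\<epsilon>\<^sup>2 \<le> (h powr (\<alpha> + real CARD('n) / 2))\<^sup>2"
        using assms by (intro power_mono) auto
      also have "\<dots> = h powr (2 * \<alpha> + real CARD('n))"
        using assms by (simp add: power2_eq_square flip: powr_add)
      finally have "\<epsilon>\<^sup>2 * h powr (- 2 * \<alpha> - real CARD('n))
          \<le> h powr (2 * \<alpha> + real CARD('n)) * h powr (- 2 * \<alpha> - real CARD('n))"
        by (intro mult_right_mono) auto
      also have "\<dots> = 1" using assms by (simp flip: powr_add)
      finally have "ennreal (\<epsilon>\<^sup>2) * ennreal (h powr (- 2 * \<alpha> - real CARD('n))) \<le> 1"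
        by (subst ennreal_mult[symmetric]) auto
      then have "ennreal (\<epsilon>\<^sup>2) * ennreal (h powr (- 2 * \<alpha> - real CARD('n))) * sobolev_mass TYPE('n) \<alpha>
          \<le> 1 * sobolev_mass TYPE('n) \<alpha>"
        by (rule mult_right_mono) simp
      then show ?thesis
        by (intro add_left_mono mult_left_mono) (simp_all add: mult.assoc)
    qed
    also have "\<dots> = 4 * sobolev_mass TYPE('n) \<alpha>"
      by (simp flip: distrib_right)
    also have "\<dots> \<le> 4 * sobolev_mass TYPE('n) \<beta>"
      unfolding sobolev_mass_def using assms
      by (intro mult_left_mono nn_integral_mono ennreal_leI mult_right_mono powr_mono) auto
    finally show ?thesis using L by simp
  qed
  ultimately show ?thesis
    using cont by (simp add: sobolev_densities_def sobolev_ellipsoid_def)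
qed

subsection \<open>The law of the observations under a Gaussian mixture\<close>

lemma space_surface_measure: "space (surface_measure :: (real ^ 'n) measure) = sphere 0 1"
  by (simp add: surface_measure_def space_scale_measure space_restrict_space)

text \<open>The sigma-algebra of \<open>surface_measure\<close> is the trace of \<open>borel\<close>
  on the sphere; this inclusion lets directions be used as Borel vectors.\<close>

lemma measurable_ident_surface_measure [measurable]:
  "(\<lambda>s. s) \<in> (surface_measure :: (real ^ 'n) measure) \<rightarrow>\<^sub>M borel"
proof -
  have "(\<lambda>s. s) \<in> restrict_space borel (sphere (0 :: real ^ 'n) 1) \<rightarrow>\<^sub>M borel"
    by (intro measurable_restrict_space1) simp
  then show ?thesis
    by (simp add: surface_measure_def cong: measurable_cong_sets)
qed

lemma sphere_area_pos: "0 < d \<Longrightarrow> 0 < sphere_area d"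
  unfolding sphere_area_def by (intro divide_pos_pos Gamma_real_pos) auto

text \<open>Tonelli, with the normalization kept outside the inner integral, so that a bound uniform
  in the direction can be inserted there.\<close>

lemma nn_integral_surface_lborel:
  fixes g :: "real ^ 'n \<Rightarrow> real \<Rightarrow> real"
  assumes [measurable]: "(\<lambda>(s, u). g s u) \<in> borel_measurable (surface_measure \<Otimes>\<^sub>M lborel)"
  shows "(\<integral>\<^sup>+(s, u). ennreal (g s u / sphere_area CARD('n)) \<partial>(surface_measure \<Otimes>\<^sub>M lborel))
    = (\<integral>\<^sup>+s. ennreal (1 / sphere_area CARD('n)) * (\<integral>\<^sup>+u. ennreal (g s u) \<partial>lborel) \<partial>surface_measure)"
proof -
  let ?a = "sphere_area CARD('n)"
  have a: "0 < ?a" by (simp add: sphere_area_pos)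
  have "(\<integral>\<^sup>+(s, u). ennreal (g s u / ?a) \<partial>(surface_measure \<Otimes>\<^sub>M lborel))
    = (\<integral>\<^sup>+s. \<integral>\<^sup>+u. ennreal (g s u / ?a) \<partial>lborel \<partial>surface_measure)"
    using lborel.nn_integral_fst[of "\<lambda>(s, u). ennreal (g s u / ?a)" surface_measure] by simp
  also have "\<dots> = (\<integral>\<^sup>+s. ennreal (1 / ?a) * (\<integral>\<^sup>+u. ennreal (g s u) \<partial>lborel) \<partial>surface_measure)"
  proof (rule nn_integral_cong)
    fix s :: "real ^ 'n" assume s: "s \<in> space surface_measure"
    have [measurable]: "g s \<in> borel_measurable lborel"
      using s by measurable
    have "(\<integral>\<^sup>+u. ennreal (g s u / ?a) \<partial>lborel) = (\<integral>\<^sup>+u. ennreal (1 / ?a) * ennreal (g s u) \<partial>lborel)"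
      using a by (intro nn_integral_cong) (simp add: ennreal_mult'[symmetric])
    also have "\<dots> = ennreal (1 / ?a) * (\<integral>\<^sup>+u. ennreal (g s u) \<partial>lborel)"
      by (rule nn_integral_cmult) measurable
    finally show "(\<integral>\<^sup>+u. ennreal (g s u / ?a) \<partial>lborel) = ennreal (1 / ?a) * (\<integral>\<^sup>+u. ennreal (g s u) \<partial>lborel)" .
  qed
  finally show ?thesis .
qed

lemma nn_integral_surface_const:
  "(\<integral>\<^sup>+s. ennreal (1 / sphere_area CARD('n)) * c \<partial>(surface_measure :: (real ^ 'n) measure)) = c"
proof -
  have "ennreal (1 / sphere_area CARD('n)) * ennreal (sphere_area CARD('n)) = 1"
    using sphere_area_pos[of "CARD('n)"] by (subst ennreal_mult'[symmetric]) auto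
  then show ?thesis
    by (simp add: space_surface_measure emeasure_surface_measure_sphere mult.commute[of _ c] mult.assoc del: ennreal_1)
qed

section \<open>One-dimensional mixtures and their likelihood ratio\<close>

lemma normal_mixture_nonneg: "0 \<le> \<epsilon> \<Longrightarrow> \<epsilon> \<le> 1 \<Longrightarrow> 0 \<le> normal_mixture \<epsilon> h \<mu> u"
  by (simp add: normal_mixture_def)

lemma nn_integral_normal_densities:
  assumes "0 \<le> a" "0 \<le> b" "0 < h"
  shows "(\<integral>\<^sup>+u. ennreal (a * normal_density \<mu> 1 u + b * normal_density \<mu> h u) \<partial>lborel) = ennreal (a + b)"
  using assms by (subst nn_integral_eq_integral) auto

text \<open>The narrow and the wide normal share their centre, so their ratio is at most its value
  1/h there. The bump thus costs \<epsilon>^2/h; a ratio of d-dimensional Gaussians would peak at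
  h^(-d) instead. This is the source of the d - 1 in the rate.\<close>

lemma nn_integral_normal_mixture_chi_square:
  assumes "0 < h" "h \<le> 1" "0 \<le> \<epsilon>" "\<epsilon> \<le> 1"
  shows "(\<integral>\<^sup>+u. ennreal ((normal_mixture \<epsilon> h \<mu> u)\<^sup>2 / normal_density \<mu> 1 u) \<partial>lborel) \<le> ennreal (1 + \<epsilon>\<^sup>2 / h)"
proof -
  have "(\<integral>\<^sup>+u. ennreal ((normal_mixture \<epsilon> h \<mu> u)\<^sup>2 / normal_density \<mu> 1 u) \<partial>lborel) \<le>
    (\<integral>\<^sup>+u. ennreal ((1 - \<epsilon>)\<^sup>2 * normal_density \<mu> 1 u + (2 * \<epsilon> * (1 - \<epsilon>) + \<epsilon>\<^sup>2 / h) * normal_density \<mu> h u) \<partial>lborel)"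
  proof (intro nn_integral_mono ennreal_leI)
    fix u
    let ?p = "normal_density \<mu> 1 u" and ?q = "normal_density \<mu> h u"
    have p: "0 < ?p" by (rule normal_density_pos) simp
    have le: "?q / ?p \<le> 1 / h"
    proof -
      have q: "?q = exp (- (u - \<mu>)\<^sup>2 / (2 * h\<^sup>2)) / (sqrt (2 * pi) * h)"
        using assms by (simp add: normal_density_def real_sqrt_mult)
      have p_eq: "?p = exp (- ((u - \<mu>)\<^sup>2 / 2)) / sqrt (2 * pi)"
        by (simp add: normal_density_def)
      have ratio: "exp a / (c * h) / (exp (- b) / c) = (1 / h) * exp (a + b)" if "c \<noteq> 0" for a b c :: real
        using that by (simp add: exp_add exp_minus field_simps)
      have "?q / ?p = (1 / h) * exp (- (u - \<mu>)\<^sup>2 / (2 * h\<^sup>2) + (u - \<mu>)\<^sup>2 / 2)"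
        unfolding q p_eq by (rule ratio) simp
      also have "\<dots> \<le> (1 / h) * 1"
      proof (rule mult_left_mono)
        have "(u - \<mu>)\<^sup>2 * 1 \<le> (u - \<mu>)\<^sup>2 * (1 / h\<^sup>2)"
          using assms by (intro mult_left_mono) (auto simp: power_le_one)
        then show "exp (- (u - \<mu>)\<^sup>2 / (2 * h\<^sup>2) + (u - \<mu>)\<^sup>2 / 2) \<le> 1"
          by simp
      qed (use assms in auto)
      finally show ?thesis by simp
    qed
    have "(normal_mixture \<epsilon> h \<mu> u)\<^sup>2 / ?p = (1 - \<epsilon>)\<^sup>2 * ?p + 2 * \<epsilon> * (1 - \<epsilon>) * ?q + \<epsilon>\<^sup>2 * (?q / ?p) * ?q"
      using p by (simp add: normal_mixture_def power2_eq_square field_simps)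
    also have "\<dots> \<le> (1 - \<epsilon>)\<^sup>2 * ?p + 2 * \<epsilon> * (1 - \<epsilon>) * ?q + \<epsilon>\<^sup>2 * (1 / h) * ?q"
      using le by (intro add_left_mono mult_right_mono mult_left_mono) auto
    finally show "(normal_mixture \<epsilon> h \<mu> u)\<^sup>2 / ?p \<le> (1 - \<epsilon>)\<^sup>2 * ?p + (2 * \<epsilon> * (1 - \<epsilon>) + \<epsilon>\<^sup>2 / h) * ?q"
      by (simp add: algebra_simps)
  qed
  also have "\<dots> = ennreal ((1 - \<epsilon>)\<^sup>2 + (2 * \<epsilon> * (1 - \<epsilon>) + \<epsilon>\<^sup>2 / h))"
    using assms by (intro nn_integral_normal_densities) auto
  also have "\<dots> \<le> ennreal (1 + \<epsilon>\<^sup>2 / h)"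
    by (intro ennreal_leI) (simp add: power2_eq_square algebra_simps)
  finally show ?thesis .
qed

lemma measurable_normal_mixture [measurable]:
  "(\<lambda>z. normal_mixture \<epsilon> h (x \<bullet> fst z) (snd z)) \<in> borel_measurable ((surface_measure :: (real ^ 'n) measure) \<Otimes>\<^sub>M lborel)"
  unfolding normal_mixture_def normal_density_def by measurable

text \<open>The formula for the Radon transform is available for unit vectors, which is enough
  because the space of \<open>surface_measure\<close> is the sphere. Measurability of the Radon side
  is inherited from the explicit side.\<close>

lemma radon_law_mixture:
  fixes x :: "real ^ 'n"
  assumes "0 < h"
  shows "radon_law (mixture \<epsilon> h x) = density (surface_measure \<Otimes>\<^sub>M lborel)
    (\<lambda>z. ennreal (normal_mixture \<epsilon> h (x \<bullet> fst z) (snd z) / sphere_area CARD('n)))"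
proof -
  let ?N = "(surface_measure :: (real ^ 'n) measure) \<Otimes>\<^sub>M (lborel :: real measure)"
  let ?f = "\<lambda>z. ennreal (normal_mixture \<epsilon> h (x \<bullet> fst z) (snd z) / sphere_area CARD('n))"
  let ?g = "\<lambda>(s, u). ennreal (radon (mixture \<epsilon> h x) s u / sphere_area CARD('n))"
  have f: "?f \<in> borel_measurable ?N" by measurable
  have eq: "?g z = ?f z" if "z \<in> space ?N" for z
    using that assms by (auto simp: space_pair_measure space_surface_measure radon_mixture)
  have "?g \<in> borel_measurable ?N"
    using f eq by (simp cong: measurable_cong)
  then show ?thesis
    unfolding radon_law_def using f eq by (intro density_cong AE_I2) auto
qed

lemma prob_space_radon_law_mixture:
  fixes x :: "real ^ 'n"
  assumes "0 < h" "0 \<le> \<epsilon>" "\<epsilon> \<le> 1"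
  shows "prob_space (radon_law (mixture \<epsilon> h x))"
proof
  let ?N = "(surface_measure :: (real ^ 'n) measure) \<Otimes>\<^sub>M (lborel :: real measure)"
  let ?f = "\<lambda>z. ennreal (normal_mixture \<epsilon> h (x \<bullet> fst z) (snd z) / sphere_area CARD('n))"
  have one: "(\<integral>\<^sup>+u. ennreal (normal_mixture \<epsilon> h (x \<bullet> s) u) \<partial>lborel) = 1" for s
    unfolding normal_mixture_def using assms by (subst nn_integral_normal_densities) auto
  have "emeasure (density ?N ?f) (space ?N) = (\<integral>\<^sup>+z. ?f z * indicator (space ?N) z \<partial>?N)"
    by (rule emeasure_density[OF _ sets.top]) measurable
  also have "\<dots> = (\<integral>\<^sup>+(s, u). ennreal (normal_mixture \<epsilon> h (x \<bullet> s) u / sphere_area CARD('n)) \<partial>?N)"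
    by (rule nn_integral_cong) (simp add: case_prod_beta)
  also have "\<dots> = 1"
    using measurable_normal_mixture[of \<epsilon> h x] nn_integral_surface_const[where c=1 and 'n='n]
    by (subst nn_integral_surface_lborel) (auto simp: case_prod_beta one)
  finally show "emeasure (radon_law (mixture \<epsilon> h x)) (space (radon_law (mixture \<epsilon> h x))) = 1"
    unfolding radon_law_mixture[OF assms(1)] space_density .
qed

text \<open>By independence the second moment of the likelihood ratio of the sample is the n-th
  power of that of one observation.\<close>

lemma mse_two_point_bound:
  fixes x :: "real ^ 'n" and T :: "'n sample \<Rightarrow> real"
  assumes "0 < h" "h \<le> 1" "0 \<le> \<epsilon>" "\<epsilon> \<le> 1" and T: "estimator n T"
  defines "f\<^sub>0 \<equiv> mixture 0 1 x" and "f\<^sub>1 \<equiv> mixture \<epsilon> h x"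
  shows "ennreal (5 / 8 * (f\<^sub>1 x - f\<^sub>0 x)\<^sup>2) \<le> mse n T x f\<^sub>1 + ennreal (2 * (1 + \<epsilon>\<^sup>2 / h) ^ n) * mse n T x f\<^sub>0"
proof -
  let ?a = "sphere_area CARD('n)"
  let ?N = "(surface_measure :: (real ^ 'n) measure) \<Otimes>\<^sub>M (lborel :: real measure)"
  \<comment> \<open>The likelihood ratio of one observation: the sphere area cancels, and the
    denominator is positive everywhere.\<close>
  define r where "r z = normal_mixture \<epsilon> h (x \<bullet> fst z) (snd z) / normal_mixture 0 1 (x \<bullet> fst z) (snd z)"
    for z :: "(real ^ 'n) \<times> real"
  have a: "0 < ?a" by (simp add: sphere_area_pos)
  have pos: "0 < normal_mixture 0 1 \<mu> u" for \<mu> u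
    by (simp add: normal_mixture_def normal_density_pos)
  have r_nonneg: "0 \<le> r z" for z
    unfolding r_def using assms by (intro divide_nonneg_pos pos normal_mixture_nonneg) auto
  have sets_law: "sets (radon_law f) = sets ?N" for f :: "real ^ 'n \<Rightarrow> real"
    by (simp add: radon_law_def)
  have rN [measurable]: "r \<in> borel_measurable ?N"
    unfolding r_def[abs_def] by measurable
  have r0 [measurable]: "r \<in> borel_measurable (radon_law f\<^sub>0)"
    using rN by (simp cong: measurable_cong_sets add: sets_law)
  have law1: "radon_law f\<^sub>1 = density (radon_law f\<^sub>0) r"
  proof -
    have "density (radon_law f\<^sub>0) r = density ?N (\<lambda>z. ennreal (normal_mixture 0 1 (x \<bullet> fst z) (snd z) / ?a) * ennreal (r z))"
      unfolding f\<^sub>0_def by (subst radon_law_mixture) (auto intro!: density_density_eq)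
    also have "\<dots> = radon_law f\<^sub>1"
      unfolding f\<^sub>1_def radon_law_mixture[OF assms(1)]
    proof (intro arg_cong[where f="density ?N"] ext)
      fix z :: "(real ^ 'n) \<times> real"
      show "ennreal (normal_mixture 0 1 (x \<bullet> fst z) (snd z) / ?a) * ennreal (r z)
          = ennreal (normal_mixture \<epsilon> h (x \<bullet> fst z) (snd z) / ?a)"
        using a pos[of "x \<bullet> fst z" "snd z"] r_nonneg[of z]
        by (subst ennreal_mult[symmetric]) (auto simp: r_def)
    qed
    finally show ?thesis by simp
  qed
  have r2: "(\<integral>\<^sup>+z. ennreal ((r z)\<^sup>2) \<partial>radon_law f\<^sub>0) \<le> ennreal (1 + \<epsilon>\<^sup>2 / h)"
  proof -
    have "(\<integral>\<^sup>+z. ennreal ((r z)\<^sup>2) \<partial>radon_law f\<^sub>0)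
      = (\<integral>\<^sup>+z. ennreal (normal_mixture 0 1 (x \<bullet> fst z) (snd z) / ?a) * ennreal ((r z)\<^sup>2) \<partial>?N)"
      unfolding f\<^sub>0_def by (subst radon_law_mixture) (auto intro!: nn_integral_density)
    also have "\<dots> = (\<integral>\<^sup>+(s, u). ennreal ((normal_mixture \<epsilon> h (x \<bullet> s) u)\<^sup>2 / normal_density (x \<bullet> s) 1 u / ?a) \<partial>?N)"
    proof (intro nn_integral_cong)
      fix z :: "(real ^ 'n) \<times> real"
      show "ennreal (normal_mixture 0 1 (x \<bullet> fst z) (snd z) / ?a) * ennreal ((r z)\<^sup>2) =
        (case z of (s, u) \<Rightarrow> ennreal ((normal_mixture \<epsilon> h (x \<bullet> s) u)\<^sup>2 / normal_density (x \<bullet> s) 1 u / ?a))"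
        using a pos[of "x \<bullet> fst z" "snd z"]
        by (subst ennreal_mult[symmetric])
           (auto simp: r_def case_prod_beta normal_mixture_def power_divide power2_eq_square)
    qed
    also have "\<dots> = (\<integral>\<^sup>+s. ennreal (1 / ?a) *
        (\<integral>\<^sup>+u. ennreal ((normal_mixture \<epsilon> h (x \<bullet> s) u)\<^sup>2 / normal_density (x \<bullet> s) 1 u) \<partial>lborel) \<partial>surface_measure)"
    proof (rule nn_integral_surface_lborel)
      have "(\<lambda>z. normal_density (x \<bullet> fst z) 1 (snd z)) \<in> borel_measurable ?N"
        unfolding normal_density_def by measurable
      then show "(\<lambda>(s, u). (normal_mixture \<epsilon> h (x \<bullet> s) u)\<^sup>2 / normal_density (x \<bullet> s) 1 u) \<in> borel_measurable ?N"
        unfolding case_prod_beta by measurable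
    qed
    also have "\<dots> \<le> (\<integral>\<^sup>+s. ennreal (1 / ?a) * ennreal (1 + \<epsilon>\<^sup>2 / h) \<partial>(surface_measure :: (real ^ 'n) measure))"
      using assms by (intro nn_integral_mono mult_left_mono nn_integral_normal_mixture_chi_square) auto
    also have "\<dots> = ennreal (1 + \<epsilon>\<^sup>2 / h)"
      by (rule nn_integral_surface_const)
    finally show ?thesis .
  qed
  have prob: "prob_space (radon_law f\<^sub>0)" "prob_space (radon_law f\<^sub>1)"
    unfolding f\<^sub>0_def f\<^sub>1_def using assms by (auto intro!: prob_space_radon_law_mixture)
  interpret P0: product_prob_space "\<lambda>_::nat. radon_law f\<^sub>0" "{1..n}"
    by (intro product_prob_spaceI prob)
  interpret P1: product_prob_space "\<lambda>_::nat. radon_law f\<^sub>1" "{1..n}"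
    by (intro product_prob_spaceI prob)
  let ?P = "\<Pi>\<^sub>M i\<in>{1..n}. radon_law f\<^sub>0"
  let ?R = "\<lambda>\<omega>. \<Prod>i\<in>{1..n}. r (\<omega> i)"
  have R_meas [measurable]: "?R \<in> borel_measurable ?P"
    by measurable
  have law: "(\<Pi>\<^sub>M i\<in>{1..n}. radon_law f\<^sub>1) = density ?P (\<lambda>\<omega>. ennreal (?R \<omega>))"
  proof -
    have "(\<Pi>\<^sub>M i\<in>{1..n}. radon_law f\<^sub>1) = density ?P (\<lambda>\<omega>. \<Prod>i\<in>{1..n}. ennreal (r (\<omega> i)))"
      unfolding law1
    proof (rule PiM_density)
      show "product_sigma_finite (\<lambda>_::nat. density (radon_law f\<^sub>0) r)"
        using P1.product_sigma_finite_axioms by (simp only: law1)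
    qed (auto intro: P0.product_sigma_finite_axioms)
    then show ?thesis by (simp add: prod_ennreal r_nonneg)
  qed
  have "ennreal (5 / 8 * (f\<^sub>1 x - f\<^sub>0 x)\<^sup>2) \<le>
    (\<integral>\<^sup>+\<omega>. ennreal (\<bar>T \<omega> - f\<^sub>1 x\<bar>\<^sup>2) \<partial>density ?P (\<lambda>\<omega>. ennreal (?R \<omega>))) +
    ennreal (2 * (1 + \<epsilon>\<^sup>2 / h) ^ n) * (\<integral>\<^sup>+\<omega>. ennreal (\<bar>T \<omega> - f\<^sub>0 x\<bar>\<^sup>2) \<partial>?P)"
  proof (rule constrained_risk_inequality)
    have "sets ?P = sets (\<Pi>\<^sub>M i\<in>{1..n}. ?N)"
      by (intro sets_PiM_cong refl sets_law)
    then show "T \<in> borel_measurable ?P"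
      using T unfolding estimator_def by (simp cong: measurable_cong_sets)
    show "0 \<le> ?R \<omega>" for \<omega>
      by (intro prod_nonneg ballI r_nonneg)
    \<comment> \<open>That \<open>?R\<close> integrates to one is read off from the product law
      under \<open>f\<^sub>1\<close> being a probability measure.\<close>
    have "prob_space (density ?P (\<lambda>\<omega>. ennreal (?R \<omega>)))"
      unfolding law[symmetric] by (intro prob_space_PiM prob)
    from prob_space.emeasure_space_1[OF this]
    have "1 = emeasure (density ?P (\<lambda>\<omega>. ennreal (?R \<omega>))) (space ?P)"
      by (simp only: space_density)
    also have "emeasure (density ?P (\<lambda>\<omega>. ennreal (?R \<omega>))) (space ?P)
        = (\<integral>\<^sup>+\<omega>. ennreal (?R \<omega>) * indicator (space ?P) \<omega> \<partial>?P)"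
      by (rule emeasure_density[OF _ sets.top]) measurable
    also have "\<dots> = (\<integral>\<^sup>+\<omega>. ennreal (?R \<omega>) \<partial>?P)"
      by (rule nn_integral_cong) simp
    finally show "(\<integral>\<^sup>+\<omega>. ennreal (?R \<omega>) \<partial>?P) = 1" by (rule sym)
    show "0 < (1 + \<epsilon>\<^sup>2 / h) ^ n"
      using assms by (intro zero_less_power add_pos_nonneg) auto
    have "(\<integral>\<^sup>+\<omega>. ennreal ((?R \<omega>)\<^sup>2) \<partial>?P) = (\<integral>\<^sup>+\<omega>. (\<Prod>i\<in>{1..n}. ennreal ((r (\<omega> i))\<^sup>2)) \<partial>?P)"
      by (simp add: prod_ennreal prod_power_distrib)
    also have "\<dots> = (\<Prod>i\<in>{1..n}. \<integral>\<^sup>+z. ennreal ((r z)\<^sup>2) \<partial>radon_law f\<^sub>0)"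
      by (intro P0.product_nn_integral_prod) auto
    also have "\<dots> \<le> ennreal (1 + \<epsilon>\<^sup>2 / h) ^ n"
      using r2 by (simp add: power_mono)
    also have "\<dots> = ennreal ((1 + \<epsilon>\<^sup>2 / h) ^ n)"
      using assms by (intro ennreal_power) auto
    finally show "(\<integral>\<^sup>+\<omega>. ennreal ((?R \<omega>)\<^sup>2) \<partial>?P) \<le> ennreal ((1 + \<epsilon>\<^sup>2 / h) ^ n)" .
  qed measurable
  then show ?thesis
    by (simp only: mse_def law)
qed

subsection \<open>The rate of adaptation\<close>

lemma one_add_power_le_exp: "0 \<le> y \<Longrightarrow> (1 + y) ^ n \<le> exp (real n * y)" for y :: real
  using power_mono[OF exp_ge_add_one_self[of y], of n] by (simp add: exp_of_nat_mult)

text \<open>At the centre the bump adds \<epsilon> times its peak and the wide component loses a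
  fraction \<open>h ^ CARD('n)\<close> of this gain. At least half remains, which gives the 4 after
  squaring.\<close>

lemma mixture_bump:
  fixes x :: "real ^ 'n"
  assumes "0 < h" "h ^ CARD('n) \<le> 1 / 2" "0 \<le> \<epsilon>"
  shows "\<epsilon>\<^sup>2 / (4 * (2 * pi) ^ CARD('n) * h ^ (2 * CARD('n))) \<le> (mixture \<epsilon> h x x - mixture 0 1 x x)\<^sup>2"
proof -
  let ?q = "sqrt (2 * pi) ^ CARD('n)" and ?H = "h ^ CARD('n)"
  have H: "0 < ?H" "1 / 2 \<le> 1 - ?H" using assms by simp_all
  have q: "0 < ?q" by simp
  have "mixture \<epsilon> h x x - mixture 0 1 x x = \<epsilon> / (?q * ?H) * (1 - ?H)"
  proof -
    have "(1 - \<epsilon>) * (1 / b) + \<epsilon> * (1 / (b * a)) - 1 / b = \<epsilon> / (b * a) * (1 - a)"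
      if "a \<noteq> 0" "b \<noteq> 0" for a b :: real
      using that by (simp add: field_simps)
    from this[of ?H ?q] have "(1 - \<epsilon>) * (1 / ?q) + \<epsilon> * (1 / (?q * ?H)) - 1 / ?q = \<epsilon> / (?q * ?H) * (1 - ?H)"
      using H q by linarith
    then show ?thesis
      by (simp add: mixture_def gauss_center power_mult_distrib)
  qed
  moreover have "\<epsilon> / (?q * ?H) * (1 / 2) \<le> \<epsilon> / (?q * ?H) * (1 - ?H)"
    using H q assms by (intro mult_left_mono) auto
  ultimately have "(\<epsilon> / (?q * ?H) * (1 / 2))\<^sup>2 \<le> (mixture \<epsilon> h x x - mixture 0 1 x x)\<^sup>2"
    using H q assms by (intro power_mono) auto
  also have "(\<epsilon> / (?q * ?H) * (1 / 2))\<^sup>2 = \<epsilon>\<^sup>2 / (4 * (2 * pi) ^ CARD('n) * h ^ (2 * CARD('n)))"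
  proof -
    have "?q\<^sup>2 = (2 * pi) ^ CARD('n)"
      by (simp flip: power_mult add: mult.commute[of _ 2]) (simp add: power_mult)
    then show ?thesis
      by (simp add: power_divide power_mult_distrib power_even_eq)
  qed
  finally show ?thesis .
qed

definition rate :: "real \<Rightarrow> real \<Rightarrow> real" where
  "rate d b = (2 * b - d) / (2 * b + d - 1)"

text \<open>The cross-multiplied difference is a positive multiple of \<open>c - b\<close>. The
  strict gap between the rates is what pays for the growth of \<open>K\<close>.\<close>

lemma rate_strict_mono:
  assumes "1 \<le> d" "d / 2 < b" "b < c"
  shows "rate d b < rate d c"
proof -
  have "0 < 2 * b + d - 1" "0 < 2 * c + d - 1" using assms by linarith+
  moreover have "(2 * b - d) * (2 * c + d - 1) < (2 * c - d) * (2 * b + d - 1)"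
  proof -
    have "(2 * c - d) * (2 * b + d - 1) - (2 * b - d) * (2 * c + d - 1) = 2 * (2 * d - 1) * (c - b)"
      by (simp add: algebra_simps)
    moreover have "0 < 2 * (2 * d - 1) * (c - b)" using assms by (intro mult_pos_pos) auto
    ultimately show ?thesis by linarith
  qed
  ultimately show ?thesis
    unfolding rate_def by (intro mult_imp_div_pos_less) (simp_all add: pos_less_divide_eq)
qed

text \<open>With \<kappa> half the gap between the rates, the second moment grows at most like
  n^\<kappa>. The scaled null term is then at most 2 C n^(-\<kappa>), so eventually half of the
  separation \<open>A\<close> remains for the alternative. \<open>A\<close> collects the 5/8, the
  factor 4 and the Gaussian constant of the bump, and the power of \<kappa> coming from
  \<open>h\<close>.\<close>

lemma adaptation_lower_bound:
  fixes x :: "real ^ 'n" and T :: "nat \<Rightarrow> 'n sample \<Rightarrow> real"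
  assumes d: "d = real CARD('n)" and b: "d / 2 < \<beta>'" "\<beta>' < \<beta>"
    and L: "4 * sobolev_mass TYPE('n) \<beta> \<le> ennreal L"
    and T: "\<And>n. 1 \<le> n \<Longrightarrow> estimator n (T n)"
    and "0 < C"
    and C: "\<And>n. 1 \<le> n \<Longrightarrow> mse n (T n) x (mixture 0 1 x) * ennreal (real n powr rate d \<beta>) \<le> ennreal C"
    and \<kappa>: "\<kappa> = (rate d \<beta> - rate d \<beta>') / 2"
    and A: "A = 5 / (32 * (2 * pi) ^ CARD('n)) * \<kappa> powr rate d \<beta>'"
  shows "eventually (\<lambda>n. ennreal (A / 2) \<le>
    (SUP f\<in>sobolev_densities \<beta>' L. mse n (T n) x f * ennreal ((real n / ln (real n)) powr rate d \<beta>'))) sequentially"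
proof -
  \<comment> \<open>For \<epsilon> = h powr (\<beta>' + d / 2), \<open>m\<close> is the exponent of
    \<open>h\<close> in \<epsilon>^2/h; hence the root in \<open>h\<close> makes this cost equal to
    \<kappa> ln n / n.\<close>
  define m where "m = 2 * \<beta>' + d - 1"
  define h where "h n = (\<kappa> * ln (real n) / real n) powr (1 / m)" for n :: nat
  have "1 \<le> d" using d by simp
  then have "0 < m" "0 < \<beta>'" using b by (auto simp: m_def)
  have "0 < \<kappa>"
    using rate_strict_mono[OF \<open>1 \<le> d\<close> b] by (simp add: \<kappa>)
  then have "0 < A" by (simp add: A)
  have h_lim: "h \<longlonglongrightarrow> 0"
  proof -
    have "(\<lambda>n. \<kappa> * ln (real n) / real n) \<longlonglongrightarrow> 0" by real_asymp
    moreover have "eventually (\<lambda>n. 0 \<le> \<kappa> * ln (real n) / real n) sequentially"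
      using eventually_ge_at_top[of 1] by eventually_elim (use \<open>0 < \<kappa>\<close> in auto)
    ultimately have "(\<lambda>n. (\<kappa> * ln (real n) / real n) powr (1 / m)) \<longlonglongrightarrow> 0"
      using \<open>0 < m\<close> by (intro tendsto_zero_powrI[where b="1 / m"]) auto
    then show ?thesis by (simp add: h_def[abs_def])
  qed
  have "(\<lambda>n. (h n) ^ CARD('n)) \<longlonglongrightarrow> 0 ^ CARD('n)"
    by (intro tendsto_power h_lim)
  then have ev1: "eventually (\<lambda>n. (h n) ^ CARD('n) < 1 / 2) sequentially"
    by (rule order_tendstoD) (simp add: zero_power)
  have ev2: "eventually (\<lambda>n. h n < 1) sequentially"
    using h_lim by (rule order_tendstoD) simp
  have "(\<lambda>n. 2 * C * real n powr (- \<kappa>)) \<longlonglongrightarrow> 0"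
    using \<open>0 < \<kappa>\<close> by real_asymp
  then have ev3: "eventually (\<lambda>n. 2 * C * real n powr (- \<kappa>) < A / 2) sequentially"
    by (rule order_tendstoD) (use \<open>0 < A\<close> in simp)
  show ?thesis
    using ev1 ev2 ev3 eventually_ge_at_top[of 3]
  proof eventually_elim
    case (elim n)
    define \<epsilon> where "\<epsilon> = h n powr (\<beta>' + d / 2)"
    define W where "W = (real n / ln (real n)) powr rate d \<beta>'"
    let ?f0 = "mixture 0 1 x" and ?f1 = "mixture \<epsilon> (h n) x"
    have n: "3 \<le> n" by fact
    \<comment> \<open>From n = 3 on the logarithm is at least 1, so the powers have positive bases
      and n / ln n is at most n.\<close>
    have "exp 1 \<le> (3 :: real)" using exp_le by simp
    then have ln1: "1 \<le> ln (real n)"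
      using n by (subst ln_ge_iff) auto
    have base: "0 < \<kappa> * ln (real n) / real n"
      using \<open>0 < \<kappa>\<close> ln1 n by simp
    have h: "0 < h n" "h n \<le> 1"
      using elim base by (auto simp: h_def)
    have h_powr: "h n powr a = (\<kappa> * ln (real n) / real n) powr (a / m)" for a
      by (simp add: h_def powr_powr)
    have \<epsilon>: "0 \<le> \<epsilon>" "\<epsilon> \<le> 1"
      using h b \<open>0 < \<beta>'\<close> d unfolding \<epsilon>_def by (auto intro!: powr_le1)
    have \<epsilon>2: "\<epsilon>\<^sup>2 = h n powr (2 * \<beta>' + d)"
      using h by (simp add: \<epsilon>_def power2_eq_square flip: powr_add)
    have K: "(1 + \<epsilon>\<^sup>2 / h n) ^ n \<le> real n powr \<kappa>"
    proof -
      have "\<epsilon>\<^sup>2 / h n = h n powr m"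
        using h unfolding \<epsilon>2 m_def powr_diff by simp
      also have "\<dots> = \<kappa> * ln (real n) / real n"
        unfolding h_powr using \<open>0 < m\<close> \<open>0 < \<kappa>\<close> ln1 by simp
      finally have "real n * (\<epsilon>\<^sup>2 / h n) = \<kappa> * ln (real n)"
        using n by simp
      then show ?thesis
        using one_add_power_le_exp[of "\<epsilon>\<^sup>2 / h n" n] h n by (simp add: powr_def)
    qed
    have bump: "A * (ln (real n) / real n) powr rate d \<beta>' \<le> 5 / 8 * (?f1 x - ?f0 x)\<^sup>2"
    proof -
      \<comment> \<open>Dividing this exponent by \<open>m\<close> gives exactly
        \<open>rate d \<beta>'\<close>.\<close>
      have "\<epsilon>\<^sup>2 / h n ^ (2 * CARD('n)) = h n powr (2 * \<beta>' - d)"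
        unfolding \<epsilon>2 powr_realpow[OF h(1), symmetric] powr_diff[symmetric] by (simp add: d)
      also have "\<dots> = \<kappa> powr rate d \<beta>' * (ln (real n) / real n) powr rate d \<beta>'"
        unfolding h_powr rate_def m_def using \<open>0 < \<kappa>\<close> ln1 n by (simp flip: powr_mult)
      finally have e: "\<epsilon>\<^sup>2 / h n ^ (2 * CARD('n)) = \<kappa> powr rate d \<beta>' * (ln (real n) / real n) powr rate d \<beta>'" .
      have "A * (ln (real n) / real n) powr rate d \<beta>' = 5 / 8 * (\<epsilon>\<^sup>2 / h n ^ (2 * CARD('n)) / (4 * (2 * pi) ^ CARD('n)))"
        unfolding e A by simp
      also have "\<dots> \<le> 5 / 8 * (?f1 x - ?f0 x)\<^sup>2"
        using mixture_bump[OF h(1) _ \<epsilon>(1), of x] elim by (intro mult_left_mono) (auto simp: mult.commute)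
      finally show ?thesis .
    qed
    have W: "0 < W" using ln1 n by (simp add: W_def)
    have "A = A * (ln (real n) / real n) powr rate d \<beta>' * W"
      using ln1 n by (simp add: W_def flip: powr_mult)
    also have "\<dots> \<le> 5 / 8 * (?f1 x - ?f0 x)\<^sup>2 * W"
      using bump W by (intro mult_right_mono) auto
    finally have "ennreal A \<le> ennreal (5 / 8 * (?f1 x - ?f0 x)\<^sup>2) * ennreal W"
      using W by (subst ennreal_mult[symmetric]) (auto intro: ennreal_leI)
    also have "\<dots> \<le> (mse n (T n) x ?f1 + ennreal (2 * (1 + \<epsilon>\<^sup>2 / h n) ^ n) * mse n (T n) x ?f0) * ennreal W"
      using h \<epsilon> n by (intro mult_right_mono mse_two_point_bound T) auto
    also have "\<dots> = mse n (T n) x ?f1 * ennreal W + (ennreal (2 * (1 + \<epsilon>\<^sup>2 / h n) ^ n) * ennreal W) * mse n (T n) x ?f0"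
      by (simp add: distrib_left mult_ac)
    \<comment> \<open>The factors before the null risk are at most 2 n^(\<kappa> + rate at
      \<beta>'). By the choice of \<kappa> this exponent is the rate at \<beta> minus \<kappa>, so
      the assumed rate leaves a vanishing term.\<close>
    also have "(ennreal (2 * (1 + \<epsilon>\<^sup>2 / h n) ^ n) * ennreal W) * mse n (T n) x ?f0 \<le> ennreal (A / 2)"
    proof -
      have "2 * (1 + \<epsilon>\<^sup>2 / h n) ^ n * W \<le> 2 * real n powr \<kappa> * real n powr rate d \<beta>'"
      proof (rule mult_mono)
        have "0 \<le> rate d \<beta>'" using \<open>0 < m\<close> b by (simp add: rate_def m_def)
        then show "W \<le> real n powr rate d \<beta>'"
          unfolding W_def using ln1 n
          by (intro powr_mono2) (auto simp: divide_le_eq mult_le_cancel_left1)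
      qed (use K W in auto)
      also have "\<dots> = 2 * real n powr (- \<kappa>) * real n powr rate d \<beta>"
      proof -
        have "\<kappa> + rate d \<beta>' = - \<kappa> + rate d \<beta>" using \<kappa> by simp
        then show ?thesis by (simp only: mult.assoc flip: powr_add)
      qed
      finally have "ennreal (2 * (1 + \<epsilon>\<^sup>2 / h n) ^ n * W) \<le> ennreal (2 * real n powr (- \<kappa>) * real n powr rate d \<beta>)"
        by (rule ennreal_leI)
      then have "(ennreal (2 * (1 + \<epsilon>\<^sup>2 / h n) ^ n) * ennreal W) * mse n (T n) x ?f0
          \<le> ennreal (2 * real n powr (- \<kappa>) * real n powr rate d \<beta>) * mse n (T n) x ?f0"
        using W by (intro mult_right_mono) (auto simp: ennreal_mult'')
      also have "\<dots> = ennreal (2 * real n powr (- \<kappa>)) * (mse n (T n) x ?f0 * ennreal (real n powr rate d \<beta>))"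
        by (simp add: ennreal_mult mult_ac)
      also have "\<dots> \<le> ennreal (2 * real n powr (- \<kappa>)) * ennreal C"
        using n by (intro mult_left_mono C) auto
      also have "\<dots> = ennreal (2 * C * real n powr (- \<kappa>))"
        using \<open>0 < C\<close> by (subst ennreal_mult[symmetric]) (auto simp: mult_ac)
      also have "\<dots> \<le> ennreal (A / 2)"
        using elim by (intro ennreal_leI) simp
      finally show ?thesis .
    qed
    finally have "ennreal (A / 2) + ennreal (A / 2) \<le> ennreal (A / 2) + mse n (T n) x ?f1 * ennreal W"
      using \<open>0 < A\<close> by (subst ennreal_plus[symmetric]) (auto simp: add_left_mono add.commute)
    then have "ennreal (A / 2) \<le> mse n (T n) x ?f1 * ennreal W"
      by (simp only: ennreal_add_left_cancel_le) simp
    also have "\<dots> \<le> (SUP f\<in>sobolev_densities \<beta>' L. mse n (T n) x f * ennreal W)"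
    proof (rule SUP_upper)
      show "?f1 \<in> sobolev_densities \<beta>' L"
        using h \<epsilon> b \<open>0 < \<beta>'\<close> L by (intro mixture_in_sobolev_densities[where \<beta>=\<beta>]) (auto simp: \<epsilon>_def d)
    qed
    finally show ?case by (simp only: W_def)
  qed
qed

text \<open>The radius is fixed by \<beta> and the dimension before \<open>C\<close> and \<beta>'
  appear, and \<open>c\<close> before \<open>x\<close>, \<open>L\<close> and the estimators, which
  expresses the required dependence of the constants.\<close>

theorem theorem3p4:
  fixes \<beta> :: real
  assumes "2 \<le> CARD('n::finite)"
    and "real CARD('n) / 2 < \<beta>"
  shows "\<exists>L\<^sub>0>0. \<forall>C>0. \<forall>\<beta>'. real CARD('n) / 2 < \<beta>' \<and> \<beta>' < \<beta> \<longrightarrow>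
    (\<exists>c>0. \<forall>x :: real ^ 'n. \<forall>L\<ge>L\<^sub>0. \<forall>T :: nat \<Rightarrow> 'n sample \<Rightarrow> real.
      (\<forall>n\<ge>1. estimator n (T n)) \<longrightarrow>
      (SUP n\<in>{1..}. SUP f\<in>sobolev_densities \<beta> L.
         mse n (T n) x f *
         ennreal (real n powr ((2 * \<beta> - real CARD('n)) / (2 * \<beta> + real CARD('n) - 1))))
        \<le> ennreal C \<longrightarrow>
      ennreal c \<le>
        liminf (\<lambda>n. SUP f\<in>sobolev_densities \<beta>' L.
          mse n (T n) x f *
          ennreal ((real n / ln (real n)) powr
            ((2 * \<beta>' - real CARD('n)) / (2 * \<beta>' + real CARD('n) - 1)))))"
proof -
  define d where "d = real CARD('n)"
  \<comment> \<open>The mass is finite, so \<open>enn2real\<close> keeps its value; the added 1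
    secures positivity.\<close>
  define L\<^sub>0 where "L\<^sub>0 = 4 * enn2real (sobolev_mass TYPE('n) \<beta>) + 1"
  have "1 \<le> d" "0 < \<beta>"
    using assms by (auto simp: d_def)
  have L0: "4 * sobolev_mass TYPE('n) \<beta> \<le> ennreal L" if "L\<^sub>0 \<le> L" for L
  proof -
    have "sobolev_mass TYPE('n) \<beta> = ennreal (enn2real (sobolev_mass TYPE('n) \<beta>))"
      using sobolev_mass_finite[OF \<open>0 < \<beta>\<close>, where 'n='n] by simp
    then have "4 * sobolev_mass TYPE('n) \<beta> = ennreal (4 * enn2real (sobolev_mass TYPE('n) \<beta>))"
      by (simp add: ennreal_mult)
    also have "\<dots> \<le> ennreal L"
      using that by (intro ennreal_leI) (simp add: L\<^sub>0_def)
    finally show ?thesis .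
  qed
  show ?thesis
    unfolding d_def[symmetric] rate_def[symmetric]
  proof (rule exI[of _ L\<^sub>0], intro conjI allI impI)
    show "0 < L\<^sub>0" by (simp add: L\<^sub>0_def add_nonneg_pos)
  next
    fix C \<beta>' :: real
    assume "0 < C" and b: "d / 2 < \<beta>' \<and> \<beta>' < \<beta>"
    define \<kappa> where "\<kappa> = (rate d \<beta> - rate d \<beta>') / 2"
    define A where "A = 5 / (32 * (2 * pi) ^ CARD('n)) * \<kappa> powr rate d \<beta>'"
    have "0 < \<kappa>"
      using rate_strict_mono[OF \<open>1 \<le> d\<close>] b by (simp add: \<kappa>_def)
    show "\<exists>c>0. \<forall>x :: real ^ 'n. \<forall>L\<ge>L\<^sub>0. \<forall>T :: nat \<Rightarrow> 'n sample \<Rightarrow> real.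
      (\<forall>n\<ge>1. estimator n (T n)) \<longrightarrow>
      (SUP n\<in>{1..}. SUP f\<in>sobolev_densities \<beta> L. mse n (T n) x f * ennreal (real n powr rate d \<beta>))
        \<le> ennreal C \<longrightarrow>
      ennreal c \<le> liminf (\<lambda>n. SUP f\<in>sobolev_densities \<beta>' L.
          mse n (T n) x f * ennreal ((real n / ln (real n)) powr rate d \<beta>'))"
    proof (intro exI[of _ "A / 2"] conjI allI impI)
      show "0 < A / 2" using \<open>0 < \<kappa>\<close> by (simp add: A_def)
    next
      fix x :: "real ^ 'n" and L and T :: "nat \<Rightarrow> 'n sample \<Rightarrow> real"
      assume "L\<^sub>0 \<le> L" and T: "\<forall>n\<ge>1. estimator n (T n)"
        and sup: "(SUP n\<in>{1..}. SUP f\<in>sobolev_densities \<beta> L. mse n (T n) x f * ennreal (real n powr rate d \<beta>))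
          \<le> ennreal C"
      \<comment> \<open>The assumed rate over the smoother class is applied to this single
        density.\<close>
      have "mixture 0 1 x \<in> sobolev_densities \<beta> L"
        using L0[OF \<open>L\<^sub>0 \<le> L\<close>] \<open>0 < \<beta>\<close> by (intro mixture_in_sobolev_densities[where \<beta>=\<beta>]) auto
      then have "mse n (T n) x (mixture 0 1 x) * ennreal (real n powr rate d \<beta>) \<le> ennreal C" if "1 \<le> n" for n
        using sup that by (auto simp: SUP_le_iff)
      then show "ennreal (A / 2) \<le> liminf (\<lambda>n. SUP f\<in>sobolev_densities \<beta>' L.
          mse n (T n) x f * ennreal ((real n / ln (real n)) powr rate d \<beta>'))"
        using b T \<open>0 < C\<close>
        by (intro Liminf_bounded adaptation_lower_bound[OF d_def _ _ L0[OF \<open>L\<^sub>0 \<le> L\<close>] _ _ _ \<kappa>_def A_def]) auto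
    qed
  qed
qed

end
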